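(* Let $(\Omega,\mathcal{F},\mathbb{P})$ be a probability space and let $\mathcal{X}\subseteq\mathbb{L}^0_+$ be convex, solid and bounded. Then the following are equivalent: (1) whenever $(X_n)_{n\in\mathbb{N}}$ is an $\mathcal{X}$-valued sequence converging to zero in $\mathbb{L}^0$, every sequence of forward convex combinations of $(X_n)_{n\in\mathbb{N}}$ also converges to zero in $\mathbb{L}^0$; (2) $0\in\mathcal{X}$ has a neighbourhood base, for the relative $\mathbb{L}^0$-topology on $\mathcal{X}$, consisting of convex sets; (3) every $X\in\mathcal{X}$ has a neighbourhood base, for the relative $\mathbb{L}^0$-topology on $\mathcal{X}$, consisting of convex sets; (4) there exists a probability $\mathbb{Q}$ equivalent to $\mathbb{P}$ such that the $\mathbb{L}^0$-topology on $\mathcal{X}$ coincides with the $\mathbb{L}^1(\mathbb{Q})$-topology on $\mathcal{X}$; (5) there exists a probability $\mathbb{Q}$ equivalent to $\mathbb{P}$ such that $\mathcal{X}$ is uniformly $\mathbb{Q}$-integrable.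
   Context: $\mathbb{L}^0$ is the space of (equivalence classes modulo $\mathbb{P}$-null sets of) real-valued random variables with the metric $(X,Y)\mapsto\mathbb{E}_{\mathbb{P}}[1\wedge|X-Y|]$ (topology of convergence in probability); $\mathbb{L}^0_+$ are its nonnegative elements. $\mathcal{X}\subseteq\mathbb{L}^0_+$ is solid if $Y\in\mathbb{L}^0_+$, $X\in\mathcal{X}$, $Y\le X$ imply $Y\in\mathcal{X}$; bounded if $\lim_{n\to\infty}\sup_{X\in\mathcal{X}}\mathbb{P}[|X|>n]=0$. A sequence of forward convex combinations of $(X_n)$ is any sequence $(Y_n)$ with $Y_n\in\mathrm{conv}\{X_k: k\ge n\}$ for all $n$. Uniform $\mathbb{Q}$-integrability means $\lim_{n\to\infty}\sup_{X\in\mathcal{X}}\mathbb{E}_{\mathbb{Q}}[|X|\mathbb{I}_{\{|X|>n\}}]=0$. *)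

theory Defs
  imports "HOL-Probability.Probability"
begin

(* Elements of L^0 are represented by real-valued measurable functions; a set of
   equivalence classes is represented by the set of all their representatives. *)

definition L0_plus :: "'a measure \<Rightarrow> ('a \<Rightarrow> real) set" where
  "L0_plus M = {X. X \<in> borel_measurable M \<and> (AE \<omega> in M. 0 \<le> X \<omega>)}"

definition solid :: "'a measure \<Rightarrow> ('a \<Rightarrow> real) set \<Rightarrow> bool" where
  "solid M C \<longleftrightarrow> (\<forall>X\<in>C. \<forall>Y\<in>L0_plus M. (AE \<omega> in M. Y \<omega> \<le> X \<omega>) \<longrightarrow> Y \<in> C)"

definition L0_bounded :: "'a measure \<Rightarrow> ('a \<Rightarrow> real) set \<Rightarrow> bool" where
  "L0_bounded M C \<longleftrightarrow>
     (\<lambda>n::nat. SUP X\<in>C. emeasure M {\<omega>\<in>space M. \<bar>X \<omega>\<bar> > real n}) \<longlonglongrightarrow> 0"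

definition fconvex :: "('a \<Rightarrow> real) set \<Rightarrow> bool" where
  "fconvex S \<longleftrightarrow> (\<forall>X\<in>S. \<forall>Y\<in>S. \<forall>t::real. 0 \<le> t \<and> t \<le> 1 \<longrightarrow>
      (\<lambda>\<omega>. t * X \<omega> + (1 - t) * Y \<omega>) \<in> S)"

definition forward_convex_comb :: "(nat \<Rightarrow> 'a \<Rightarrow> real) \<Rightarrow> (nat \<Rightarrow> 'a \<Rightarrow> real) \<Rightarrow> bool" where
  "forward_convex_comb X Y \<longleftrightarrow> (\<forall>n. \<exists>I w. finite I \<and> I \<noteq> {} \<and> I \<subseteq> {n..} \<and>
      (\<forall>k\<in>I. 0 \<le> w k) \<and> (\<Sum>k\<in>I. w k) = (1::real) \<and>
      Y n = (\<lambda>\<omega>. \<Sum>k\<in>I. w k * X k \<omega>))"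

definition L0_dist :: "'a measure \<Rightarrow> ('a \<Rightarrow> real) \<Rightarrow> ('a \<Rightarrow> real) \<Rightarrow> ennreal" where
  "L0_dist M X Y = (\<integral>\<^sup>+ \<omega>. ennreal (min 1 \<bar>X \<omega> - Y \<omega>\<bar>) \<partial>M)"

definition L1_dist :: "'a measure \<Rightarrow> ('a \<Rightarrow> real) \<Rightarrow> ('a \<Rightarrow> real) \<Rightarrow> ennreal" where
  "L1_dist Q X Y = (\<integral>\<^sup>+ \<omega>. ennreal \<bar>X \<omega> - Y \<omega>\<bar> \<partial>Q)"

definition rel_nhd :: "('b \<Rightarrow> 'b \<Rightarrow> ennreal) \<Rightarrow> 'b set \<Rightarrow> 'b \<Rightarrow> 'b set \<Rightarrow> bool" where
  "rel_nhd d C X U \<longleftrightarrow> U \<subseteq> C \<and> (\<exists>\<delta>>0. {Y\<in>C. d X Y < \<delta>} \<subseteq> U)"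

definition convex_nhd_base :: "'a measure \<Rightarrow> ('a \<Rightarrow> real) set \<Rightarrow> ('a \<Rightarrow> real) \<Rightarrow> bool" where
  "convex_nhd_base M C X \<longleftrightarrow>
     (\<forall>V. rel_nhd (L0_dist M) C X V \<longrightarrow> (\<exists>U. rel_nhd (L0_dist M) C X U \<and> fconvex U \<and> U \<subseteq> V))"

definition equiv_prob :: "'a measure \<Rightarrow> 'a measure \<Rightarrow> bool" where
  "equiv_prob M Q \<longleftrightarrow> prob_space Q \<and> sets Q = sets M \<and> space Q = space M \<and>
     (\<forall>A\<in>sets M. emeasure M A = 0 \<longleftrightarrow> emeasure Q A = 0)"

definition unif_integrable :: "'a measure \<Rightarrow> ('a \<Rightarrow> real) set \<Rightarrow> bool" where
  "unif_integrable Q C \<longleftrightarrow>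
     (\<lambda>n::nat. SUP X\<in>C. \<integral>\<^sup>+ \<omega>. ennreal (\<bar>X \<omega>\<bar> * indicator {\<omega>. \<bar>X \<omega>\<bar> > real n} \<omega>) \<partial>Q)
       \<longlonglongrightarrow> 0"

end

theory Submission
  imports Defs
begin

text \<open>
  The implications (5) to (4), (4) to (3), (3) to (2) and (2) to (1) are direct; the heart is (1) to (5).
  By (1) and boundedness, the convex hulls \<open>K\<^sub>m\<close> of the tails \<open>X 1\<^bsub>{X > m}\<^esub>\<close>, \<open>X \<in> C\<close>, are
  uniformly small in \<open>L\<^sup>0\<close> as \<open>m\<close> grows. If \<open>K\<close> is convex with \<open>E[1 \<and> Y] \<le> \<eta>\<close> on \<open>K\<close>, minimizing
  \<open>E[1 / (1 + Y)]\<close> over \<open>K\<close> and writing \<open>V\<close> for the limit of \<open>1 / (1 + Y\<^sub>n)\<close> along a minimizing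
  sequence, the first-order condition reads \<open>E[V\<^sup>2 (1 + Y)] \<le> E[V]\<close>, so \<open>E[V\<^sup>2 Y] \<le> \<eta>\<close> while
  \<open>E[1 - V] \<le> \<eta>\<close>. Hence \<open>B = {V \<ge> 1/2}\<close> has almost full measure and \<open>E[Y 1\<^bsub>B\<^esub>] \<le> 4 \<eta>\<close> for all
  \<open>Y \<in> K\<close> at once. Applying this to \<open>K\<^bsub>m k\<^esub>\<close> with \<open>\<eta> = 2\<^sup>-\<^sup>k\<close> gives sets \<open>B\<^sub>k\<close>; by Borel-Cantelli the
  sets \<open>A\<^sub>j = \<Inter>\<^bsub>k \<ge> j\<^esub> B\<^sub>k\<close> exhaust the space, and a density \<open>\<Sum>\<^sub>j c\<^sub>j 1\<^bsub>A j\<^esub>\<close> with rapidly decreasing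
  \<open>c\<^sub>j\<close> yields \<open>Q\<close>.
\<close>

subsection \<open>Weights for convex sets that are small in probability\<close>

text \<open>With \<open>u = 1/(1+a)\<close> and \<open>v = 1/(1+b)\<close> the left side is the
  harmonic mean \<open>2uv/(u+v)\<close>. It falls short of the arithmetic mean by exactly
  \<open>(u-v)^2 / (2(u+v))\<close>, and \<open>u + v\<close> is at most 2. The spelling
  \<open>1 - 1/2\<close> matches \<open>fconvex\<close> at \<open>t = 1/2\<close>.\<close>

lemma harmonic_midpoint_gap:
  fixes a b :: real
  assumes "0 \<le> a" "0 \<le> b"
  shows "1 / (1 + (1/2 * a + (1 - 1/2) * b)) \<le>
    (1 / (1 + a) + 1 / (1 + b)) / 2 - (1 / (1 + a) - 1 / (1 + b))\<^sup>2 / 4"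
proof -
  define u v where "u = 1 / (1 + a)" and "v = 1 / (1 + b)"
  have uv: "0 < u" "u \<le> 1" "0 < v" "v \<le> 1" using assms by (auto simp: u_def v_def)
  have "1 + (1/2 * a + (1 - 1/2) * b) = (1 / u + 1 / v) / 2"
    by (simp add: u_def v_def field_simps)
  also have "\<dots> = (u + v) / (2 * u * v)" using uv by (simp add: field_simps)
  finally have "1 / (1 + (1/2 * a + (1 - 1/2) * b)) = 2 * u * v / (u + v)" by simp
  also have "\<dots> = (u + v) / 2 - (u - v)\<^sup>2 / (2 * (u + v))"
    using uv by (simp add: divide_simps power2_eq_square) (simp add: algebra_simps)
  also have "\<dots> \<le> (u + v) / 2 - (u - v)\<^sup>2 / 4"
    using uv by (intro diff_left_mono divide_left_mono) auto
  finally show ?thesis by (simp only: u_def v_def)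
qed

context prob_space
begin

text \<open>Strict convexity of \<open>y \<mapsto> 1 / (1 + y)\<close> makes a minimizing sequence Cauchy in \<open>L\<^sup>2\<close>.
  The limit \<open>V\<close> may vanish, i.e. the minimizer itself need not be finite; this is why the
  argument is carried out in terms of \<open>V\<close> throughout.\<close>

lemma AE_convergent_minimizing_sequence:
  fixes K :: "('a \<Rightarrow> real) set" and F :: "('a \<Rightarrow> real) \<Rightarrow> real"
  assumes "K \<noteq> {}" and "fconvex K" and "K \<subseteq> L0_plus M"
    and F_def: "\<And>Y. F Y = expectation (\<lambda>x. 1 / (1 + \<bar>Y x\<bar>))"
  obtains Y V where "\<And>n. Y n \<in> K" "V \<in> borel_measurable M"
    "AE x in M. (\<lambda>n. 1 / (1 + \<bar>Y n x\<bar>)) \<longlonglongrightarrow> V x"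
    "(\<lambda>n. F (Y n)) \<longlonglongrightarrow> (INF Z\<in>K. F Z)" "bdd_below (F ` K)"
proof -
  have meas[measurable]: "Z \<in> borel_measurable M" if "Z \<in> K" for Z
    using that assms(3) by (auto simp: L0_plus_def)
  have pos: "AE x in M. 0 \<le> Z x" if "Z \<in> K" for Z
    using that assms(3) by (auto simp: L0_plus_def)
  have int: "integrable M (\<lambda>x. 1 / (1 + \<bar>Z x\<bar>))" if "Z \<in> K" for Z
    using that by (intro integrable_const_bound[where B = 1]) auto
  define i where "i = (INF Z\<in>K. F Z)"
  have bdd: "bdd_below (F ` K)"
    by (rule bdd_belowI2[where m = 0]) (auto simp: F_def intro!: Bochner_Integration.integral_nonneg)
  have i_le: "i \<le> F Z" if "Z \<in> K" for Z
    unfolding i_def using bdd that by (rule cINF_lower)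
  have "\<exists>Z\<in>K. F Z < i + 1 / real (Suc n)" for n
    using cINF_less_iff[OF assms(1) bdd, of "i + 1 / real (Suc n)"] by (simp add: i_def)
  then obtain Y where Y: "\<And>n. Y n \<in> K" "\<And>n. F (Y n) < i + 1 / real (Suc n)" by metis
  note [measurable] = meas[OF Y(1)]
  define v where "v n x = 1 / (1 + \<bar>Y n x\<bar>)" for n x
  have [measurable]: "v n \<in> borel_measurable M" for n unfolding v_def by measurable
  have v01: "0 \<le> v n x" "v n x \<le> 1" for n x by (auto simp: v_def)
  have int_v: "integrable M (v n)" for n unfolding v_def by (rule int[OF Y(1)])
  have int_sq: "integrable M (\<lambda>x. (v n x - v m x)\<^sup>2)" for n m
  proof (rule integrable_const_bound[where B = 1])
    have "\<bar>v n x - v m x\<bar> \<le> 1" for x using v01[of n x] v01[of m x] by linarith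
    then show "AE x in M. norm ((v n x - v m x)\<^sup>2) \<le> 1" by (simp add: abs_square_le_1)
  qed measurable
  \<comment> \<open>The midpoint \<open>W\<close> lies in \<open>K\<close>, so \<open>F W\<close> is
    at least the infimum \<open>i\<close>, while \<open>F (Y n)\<close> and \<open>F (Y m)\<close>
    exceed \<open>i\<close> by little. Hence the quadratic gain in the midpoint inequality must be
    small.\<close>
  have gap: "expectation (\<lambda>x. (v n x - v m x)\<^sup>2) \<le> 2 * (1 / real (Suc n) + 1 / real (Suc m))" for n m
  proof -
    define W where "W = (\<lambda>x. 1/2 * Y n x + (1 - 1/2) * Y m x)"
    have W: "W \<in> K"
      unfolding W_def using assms(2) Y(1)[of n] Y(1)[of m] unfolding fconvex_def
      by (elim ballE[of _ _ "Y n"] ballE[of _ _ "Y m"] allE[of _ "1/2"]) auto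
    have "F W \<le> expectation (\<lambda>x. (v n x + v m x) / 2 - (v n x - v m x)\<^sup>2 / 4)"
      unfolding F_def
    proof (rule integral_mono_AE)
      show "integrable M (\<lambda>x. 1 / (1 + \<bar>W x\<bar>))" by (rule int[OF W])
      show "integrable M (\<lambda>x. (v n x + v m x) / 2 - (v n x - v m x)\<^sup>2 / 4)"
        using int_v int_sq by simp
      show "AE x in M. 1 / (1 + \<bar>W x\<bar>) \<le> (v n x + v m x) / 2 - (v n x - v m x)\<^sup>2 / 4"
        using pos[OF Y(1)[of n]] pos[OF Y(1)[of m]] pos[OF W]
      proof eventually_elim
        case (elim x)
        then show ?case
          using harmonic_midpoint_gap[of "Y n x" "Y m x"] by (simp add: v_def W_def)
      qed
    qed
    also have "\<dots> = (F (Y n) + F (Y m)) / 2 - expectation (\<lambda>x. (v n x - v m x)\<^sup>2) / 4"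
      using int_v int_sq by (simp add: F_def v_def[symmetric])
    finally show ?thesis
      using i_le[OF W] Y(2)[of n] Y(2)[of m]
      by argo
  qed
  have "\<exists>N. \<forall>n\<ge>N. \<forall>m\<ge>N. expectation (\<lambda>x. norm (v n x - v m x)) < e" if e: "0 < e" for e
  proof -
    \<comment> \<open>For indices beyond \<open>N\<close> the bound \<open>gap\<close> is below
      \<open>4 / N\<close>, hence below \<open>e^2\<close>.\<close>
    obtain N where N: "4 / e\<^sup>2 < real N" using reals_Archimedean2 by blast
    have "expectation (\<lambda>x. norm (v n x - v m x)) < e" if "n \<ge> N" "m \<ge> N" for n m
    proof -
      have N0: "0 < real N" using N e by (smt (verit) divide_nonneg_nonneg zero_le_power2)
      have frac: "1 / real (Suc k) < 1 / real N" if "k \<ge> N" for k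
        using that N0 by (intro divide_strict_left_mono) auto
      have eN: "4 * (1 / real N) < e\<^sup>2" using N N0 e by (simp add: field_simps)
      have sq: "expectation (\<lambda>x. (v n x - v m x)\<^sup>2) < e\<^sup>2"
        using gap[of n m] frac[OF that(1)] frac[OF that(2)] eN by argo
      \<comment> \<open>Young's inequality \<open>|d| <= e/2 + d^2/(2e)\<close> plays the role of
        Cauchy-Schwarz in passing from L2 to L1.\<close>
      have "expectation (\<lambda>x. norm (v n x - v m x)) \<le>
          expectation (\<lambda>x. e / 2 + (v n x - v m x)\<^sup>2 / (2 * e))"
      proof (rule integral_mono)
        show "integrable M (\<lambda>x. norm (v n x - v m x))" using int_v by simp
        show "integrable M (\<lambda>x. e / 2 + (v n x - v m x)\<^sup>2 / (2 * e))" using int_sq by simp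
        fix x
        have "0 \<le> (\<bar>v n x - v m x\<bar> - e)\<^sup>2" by simp
        then show "norm (v n x - v m x) \<le> e / 2 + (v n x - v m x)\<^sup>2 / (2 * e)"
          using e by (simp add: field_simps power2_eq_square)
      qed
      also have "\<dots> = e / 2 + expectation (\<lambda>x. (v n x - v m x)\<^sup>2) / (2 * e)"
        using int_sq by (simp add: prob_space)
      also have "\<dots> < e" using sq e by (simp add: field_simps power2_eq_square)
      finally show ?thesis .
    qed
    then show ?thesis by blast
  qed
  then obtain r where r: "strict_mono r" "AE x in M. Cauchy (\<lambda>n. v (r n) x)"
    using cauchy_L1_AE_cauchy_subseq[of M v] int_v by blast
  \<comment> \<open>Where the sequence diverges, \<open>lim\<close> takes an unspecified value; this
    happens only on a null set, and \<open>V\<close> is measurable everywhere.\<close>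
  define V where "V x = lim (\<lambda>n. v (r n) x)" for x
  show ?thesis
  proof
    show "Y (r n) \<in> K" for n by (rule Y(1))
    show "V \<in> borel_measurable M" unfolding V_def by measurable
    show "AE x in M. (\<lambda>n. 1 / (1 + \<bar>Y (r n) x\<bar>)) \<longlonglongrightarrow> V x"
      using r(2) by eventually_elim
        (auto simp: V_def v_def[symmetric] Cauchy_convergent_iff convergent_LIMSEQ_iff)
    have "(\<lambda>n. F (Y n)) \<longlonglongrightarrow> i"
    proof (rule tendsto_sandwich[OF _ _ tendsto_const])
      show "\<forall>\<^sub>F n in sequentially. i \<le> F (Y n)" using i_le Y(1) by simp
      show "\<forall>\<^sub>F n in sequentially. F (Y n) \<le> i + 1 / real (Suc n)"
        using Y(2) by (simp add: less_imp_le)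
      show "(\<lambda>n. i + 1 / real (Suc n)) \<longlonglongrightarrow> i"
        using tendsto_add[OF tendsto_const LIMSEQ_Suc[OF lim_1_over_n]] by simp
    qed
    from LIMSEQ_subseq_LIMSEQ[OF this r(1)]
    show "(\<lambda>n. F (Y (r n))) \<longlonglongrightarrow> (INF Z\<in>K. F Z)" by (simp add: i_def o_def)
    show "bdd_below (F ` K)" by (rule bdd)
  qed
qed

text \<open>One weight serves all of \<open>K\<close> because the optimality of \<open>V\<close> can
  be tested in the direction of every \<open>Z\<close> in \<open>K\<close>. Since
  \<open>V - V^2 <= 1 - V\<close>, the resulting first-order condition bounds
  \<open>E[V^2 |Z|]\<close> by \<open>E[V] - E[V^2] <= E[1 - V]\<close>.\<close>

lemma convex_weight:
  fixes K :: "('a \<Rightarrow> real) set"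
  assumes "K \<noteq> {}" and "fconvex K" and "K \<subseteq> L0_plus M" and "0 \<le> \<eta>"
    and small: "\<And>Y. Y \<in> K \<Longrightarrow> L0_dist M Y (\<lambda>_. 0) \<le> ennreal \<eta>"
  obtains V where "V \<in> borel_measurable M" "AE x in M. 0 \<le> V x \<and> V x \<le> 1"
    "expectation (\<lambda>x. 1 - V x) \<le> \<eta>"
    "\<And>Y. Y \<in> K \<Longrightarrow> (\<integral>\<^sup>+ x. ennreal ((V x)\<^sup>2 * \<bar>Y x\<bar>) \<partial>M) \<le> ennreal \<eta>"
proof -
  define F where "F Y = expectation (\<lambda>x. 1 / (1 + \<bar>Y x\<bar>))" for Y :: "'a \<Rightarrow> real"
  obtain Y V where Y: "\<And>n. Y n \<in> K" and V[measurable]: "V \<in> borel_measurable M"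
    and lim: "AE x in M. (\<lambda>n. 1 / (1 + \<bar>Y n x\<bar>)) \<longlonglongrightarrow> V x"
    and limF: "(\<lambda>n. F (Y n)) \<longlonglongrightarrow> (INF Z\<in>K. F Z)" and bdd: "bdd_below (F ` K)"
    by (rule AE_convergent_minimizing_sequence[OF assms(1-3) F_def]) (rule that)
  have meas[measurable]: "Z \<in> borel_measurable M" if "Z \<in> K" for Z
    using that assms(3) by (auto simp: L0_plus_def)
  have pos: "AE x in M. 0 \<le> Z x" if "Z \<in> K" for Z
    using that assms(3) by (auto simp: L0_plus_def)
  note [measurable] = meas[OF Y]
  define i where "i = (INF Z\<in>K. F Z)"
  have i_le: "i \<le> F Z" if "Z \<in> K" for Z
    unfolding i_def using bdd that by (rule cINF_lower)
  have V01: "AE x in M. 0 \<le> V x \<and> V x \<le> 1"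
    using lim
  proof eventually_elim
    case (elim x)
    show ?case
      by (intro conjI LIMSEQ_le_const[OF elim] LIMSEQ_le_const2[OF elim]) auto
  qed
  have "(\<lambda>n. F (Y n)) \<longlonglongrightarrow> expectation V"
    unfolding F_def
    by (rule integral_dominated_convergence[where w = "\<lambda>_. 1"]) (use lim in auto)
  with limF have EV: "expectation V = i"
    unfolding i_def by (rule LIMSEQ_unique[symmetric])
  have int_V: "integrable M V"
    by (rule integrable_const_bound[where B = 1]) (use V01 in auto)
  have int_VV: "integrable M (\<lambda>x. (V x)\<^sup>2)"
    by (rule integrable_const_bound[where B = 1]) (use V01 in \<open>auto simp: abs_square_le_1\<close>)
  \<comment> \<open>Uses \<open>1 - 1/(1+z) = z/(1+z) <= min 1 z\<close> for nonnegative
    \<open>z\<close>; the bound then passes to the infimum, which equals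
    \<open>E[V]\<close>.\<close>
  have F_ge: "1 - \<eta> \<le> F Z" if Z: "Z \<in> K" for Z
  proof -
    note [measurable] = meas[OF Z]
    have int: "integrable M (\<lambda>x. min 1 \<bar>Z x\<bar>)"
      by (rule integrable_const_bound[where B = 1]) auto
    have int2: "integrable M (\<lambda>x. 1 / (1 + \<bar>Z x\<bar>))"
      by (rule integrable_const_bound[where B = 1]) auto
    have "ennreal (expectation (\<lambda>x. min 1 \<bar>Z x\<bar>)) = L0_dist M Z (\<lambda>_. 0)"
      unfolding L0_dist_def using nn_integral_eq_integral[OF int] by simp
    with small[OF Z] have "expectation (\<lambda>x. min 1 \<bar>Z x\<bar>) \<le> \<eta>"
      using assms(4) by (metis ennreal_le_iff)
    moreover have "expectation (\<lambda>x. 1 - 1 / (1 + \<bar>Z x\<bar>)) \<le> expectation (\<lambda>x. min 1 \<bar>Z x\<bar>)"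
    proof (rule integral_mono)
      show "1 - 1 / (1 + \<bar>Z x\<bar>) \<le> min 1 \<bar>Z x\<bar>" for x
        by (auto simp: field_simps)
    qed (use int int2 in auto)
    ultimately show ?thesis
      using int2 by (simp add: F_def prob_space)
  qed
  then have "1 - \<eta> \<le> i"
    unfolding i_def using assms(1) by (intro cINF_greatest) auto
  then have EV1: "expectation (\<lambda>x. 1 - V x) \<le> \<eta>"
    using int_V EV by (simp add: prob_space)
  \<comment> \<open>optimality of \<open>V\<close> against the perturbation \<open>t Z + (1 - t) Y\<^sub>n\<close>; letting \<open>t\<close> tend to \<open>0\<close>
    gives \<open>E[V\<^sup>2 (1 + Z)] \<le> E[V]\<close>\<close>
  have first_order: "(\<integral>\<^sup>+ x. ennreal ((V x)\<^sup>2 * (1 + \<bar>Z x\<bar>) / (1 - t + t * (V x * (1 + \<bar>Z x\<bar>)))) \<partial>M)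
      \<le> ennreal (expectation V / (1 - t))" if Z: "Z \<in> K" and t: "0 < t" "t < 1" for Z t
  proof -
    note [measurable] = meas[OF Z]
    \<comment> \<open>For \<open>v = 1/(1+y)\<close> one has
      \<open>1 + t z + (1-t) y = (1 - t + t v (1+z)) / v\<close>. So the perturbed integrands
      converge to \<open>g = V / D\<close> even where \<open>V\<close> vanishes and
      \<open>Y n\<close> itself has no finite limit.\<close>
    define D where "D x = 1 - t + t * (V x * (1 + \<bar>Z x\<bar>))" for x
    define g where "g x = V x / D x" for x
    define h where "h x = (V x)\<^sup>2 * (1 + \<bar>Z x\<bar>) / D x" for x
    have [measurable]: "D \<in> borel_measurable M" "g \<in> borel_measurable M" "h \<in> borel_measurable M"
      unfolding D_def g_def h_def by measurable
    have D: "AE x in M. 1 - t \<le> D x"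
      using V01 by eventually_elim (use t in \<open>auto simp: D_def\<close>)
    have g_le: "AE x in M. 0 \<le> g x \<and> g x \<le> V x / (1 - t)"
      using V01 D by eventually_elim
        (use t in \<open>auto simp: g_def intro!: divide_nonneg_pos divide_left_mono mult_pos_pos\<close>)
    have int_g: "integrable M g"
    proof (rule Bochner_Integration.integrable_bound)
      show "integrable M (\<lambda>x. V x / (1 - t))" using int_V by simp
      show "AE x in M. norm (g x) \<le> norm (V x / (1 - t))"
        using g_le by eventually_elim (simp del: abs_divide)
    qed measurable
    \<comment> \<open>Every perturbation lies in the convex set \<open>K\<close>, so its value under
      \<open>F\<close> is at least \<open>i\<close>; dominated convergence in \<open>n\<close>
      carries this over to \<open>g\<close>.\<close>
    have "i \<le> expectation g"
    proof (rule LIMSEQ_le_const)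
      show "(\<lambda>n. F (\<lambda>x. t * Z x + (1 - t) * Y n x)) \<longlonglongrightarrow> expectation g"
        unfolding F_def
      proof (rule integral_dominated_convergence[where w = "\<lambda>_. 1"])
        show "AE x in M. (\<lambda>n. 1 / (1 + \<bar>t * Z x + (1 - t) * Y n x\<bar>)) \<longlonglongrightarrow> g x"
        proof -
          have "AE x in M. \<forall>n. 0 \<le> Y n x" using pos[OF Y] by (simp add: AE_all_countable)
          with lim pos[OF Z] D show ?thesis
          proof eventually_elim
            case (elim x)
            have "1 / (1 + \<bar>t * Z x + (1 - t) * Y n x\<bar>) =
                (1 / (1 + \<bar>Y n x\<bar>)) / (1 - t + t * ((1 / (1 + \<bar>Y n x\<bar>)) * (1 + \<bar>Z x\<bar>)))" for n
            proof -
              have "0 \<le> t * Z x + (1 - t) * Y n x" "0 \<le> Y n x" using elim t by simp_all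
              moreover have "1 - t + t * ((1 / (1 + Y n x)) * (1 + Z x)) =
                  (1 + (t * Z x + (1 - t) * Y n x)) / (1 + Y n x)"
                using elim(4)[rule_format, of n] by (simp add: field_simps)
              moreover have "1 + Y n x \<noteq> 0" using elim(4)[rule_format, of n] by simp
              ultimately show ?thesis using elim by simp
            qed
            moreover have "(\<lambda>n. (1 / (1 + \<bar>Y n x\<bar>)) /
                (1 - t + t * ((1 / (1 + \<bar>Y n x\<bar>)) * (1 + \<bar>Z x\<bar>)))) \<longlonglongrightarrow> g x"
              unfolding g_def D_def using elim t by (intro tendsto_intros) (auto simp: D_def)
            ultimately show ?case by simp
          qed
        qed
      qed auto
      show "\<exists>N. \<forall>n\<ge>N. i \<le> F (\<lambda>x. t * Z x + (1 - t) * Y n x)"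
        using assms(2) Z Y t by (auto intro!: i_le simp: fconvex_def)
    qed
    then have le: "expectation V \<le> expectation g" using EV by simp
    \<comment> \<open>Thus \<open>h - g\<close> is the difference quotient of the perturbation. The
      right side consists of integrable functions, which gives access to the integral of
      \<open>h\<close> before anything is known about the integrability of \<open>Z\<close>.\<close>
    have h_eq: "AE x in M. h x = (V x - g x) / t + g x"
      using D
    proof eventually_elim
      case (elim x)
      then have "D x > 0" using t by simp
      then show ?case using t
        unfolding h_def g_def
        by (simp add: divide_simps) (simp add: D_def power2_eq_square algebra_simps)
    qed
    have int_h': "integrable M (\<lambda>x. (V x - g x) / t + g x)" using int_V int_g by simp
    have h0: "AE x in M. 0 \<le> (V x - g x) / t + g x"
      using h_eq D V01
    proof eventually_elim
      case (elim x)
      then have "0 < D x" using t by simp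
      then have "0 \<le> h x" unfolding h_def by simp
      with elim(1) show ?case by simp
    qed
    have "(\<integral>\<^sup>+ x. ennreal (h x) \<partial>M) = (\<integral>\<^sup>+ x. ennreal ((V x - g x) / t + g x) \<partial>M)"
      by (rule nn_integral_cong_AE) (use h_eq in auto)
    also have "\<dots> = ennreal (expectation (\<lambda>x. (V x - g x) / t + g x))"
      by (rule nn_integral_eq_integral[OF int_h' h0])
    also have "expectation (\<lambda>x. (V x - g x) / t + g x) =
        (expectation V - expectation g) / t + expectation g"
      using int_V int_g by simp
    \<comment> \<open>Optimality makes the difference quotient nonpositive in mean, and
      \<open>g <= V / (1-t)\<close> bounds the remainder.\<close>
    also have "ennreal \<dots> \<le> ennreal (expectation V / (1 - t))"
    proof (rule ennreal_leI)
      have "(expectation V - expectation g) / t \<le> 0" using le t by (simp add: divide_nonpos_pos)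
      moreover have "expectation g \<le> expectation (\<lambda>x. V x / (1 - t))"
        by (rule integral_mono_AE) (use int_g int_V g_le in auto)
      ultimately show "(expectation V - expectation g) / t + expectation g \<le> expectation V / (1 - t)"
        by simp
    qed
    finally show ?thesis by (simp add: h_def D_def)
  qed
  have "(\<integral>\<^sup>+ x. ennreal ((V x)\<^sup>2 * \<bar>Z x\<bar>) \<partial>M) \<le> ennreal \<eta>" if Z: "Z \<in> K" for Z
  proof -
    note [measurable] = meas[OF Z]
    \<comment> \<open>The double successor keeps \<open>t 0\<close> strictly below 1. Fatou's lemma
      along \<open>t n\<close> then yields the limiting first-order condition.\<close>
    define t where "t n = 1 / real (Suc (Suc n))" for n
    have t: "0 < t n" "t n < 1" for n by (auto simp: t_def)
    have t0: "t \<longlonglongrightarrow> 0" unfolding t_def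
      using LIMSEQ_Suc[OF LIMSEQ_Suc[OF lim_1_over_n]] by simp
    define h where "h n x = (V x)\<^sup>2 * (1 + \<bar>Z x\<bar>) / (1 - t n + t n * (V x * (1 + \<bar>Z x\<bar>)))" for n x
    have [measurable]: "h n \<in> borel_measurable M" for n unfolding h_def by measurable
    have "(\<integral>\<^sup>+ x. ennreal ((V x)\<^sup>2 * (1 + \<bar>Z x\<bar>)) \<partial>M) =
        (\<integral>\<^sup>+ x. liminf (\<lambda>n. ennreal (h n x)) \<partial>M)"
    proof (rule nn_integral_cong)
      fix x
      have "(\<lambda>n. h n x) \<longlonglongrightarrow> (V x)\<^sup>2 * (1 + \<bar>Z x\<bar>) / (1 - 0 + 0 * (V x * (1 + \<bar>Z x\<bar>)))"
        unfolding h_def by (intro tendsto_intros t0) auto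
      then have "(\<lambda>n. ennreal (h n x)) \<longlonglongrightarrow> ennreal ((V x)\<^sup>2 * (1 + \<bar>Z x\<bar>))" by simp
      then show "ennreal ((V x)\<^sup>2 * (1 + \<bar>Z x\<bar>)) = liminf (\<lambda>n. ennreal (h n x))"
        by (simp add: lim_imp_Liminf)
    qed
    also have "\<dots> \<le> liminf (\<lambda>n. \<integral>\<^sup>+ x. ennreal (h n x) \<partial>M)"
      by (rule nn_integral_liminf) simp
    also have "\<dots> \<le> liminf (\<lambda>n. ennreal (expectation V / (1 - t n)))"
      by (rule Liminf_mono) (use first_order[OF Z] t in \<open>auto simp: h_def\<close>)
    also have "\<dots> = ennreal (expectation V)"
    proof -
      have "(\<lambda>n. expectation V / (1 - t n)) \<longlonglongrightarrow> expectation V / (1 - 0)"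
        by (intro tendsto_intros t0) auto
      then have "(\<lambda>n. ennreal (expectation V / (1 - t n))) \<longlonglongrightarrow> ennreal (expectation V)"
        by simp
      then show ?thesis by (simp add: lim_imp_Liminf)
    qed
    finally have *: "(\<integral>\<^sup>+ x. ennreal ((V x)\<^sup>2 * (1 + \<bar>Z x\<bar>)) \<partial>M) \<le> ennreal (expectation V)" .
    have "(\<integral>\<^sup>+ x. ennreal ((V x)\<^sup>2 * (1 + \<bar>Z x\<bar>)) \<partial>M) =
        (\<integral>\<^sup>+ x. ennreal ((V x)\<^sup>2) + ennreal ((V x)\<^sup>2 * \<bar>Z x\<bar>) \<partial>M)"
      by (intro nn_integral_cong) (simp add: algebra_simps flip: ennreal_plus)
    also have "\<dots> = ennreal (expectation (\<lambda>x. (V x)\<^sup>2)) + (\<integral>\<^sup>+ x. ennreal ((V x)\<^sup>2 * \<bar>Z x\<bar>) \<partial>M)"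
      using nn_integral_eq_integral[OF int_VV] by (subst nn_integral_add) auto
    finally have le: "ennreal (expectation (\<lambda>x. (V x)\<^sup>2)) + (\<integral>\<^sup>+ x. ennreal ((V x)\<^sup>2 * \<bar>Z x\<bar>) \<partial>M)
        \<le> ennreal (expectation V)" using * by simp
    have VV: "expectation V - expectation (\<lambda>x. (V x)\<^sup>2) \<le> \<eta>"
    proof -
      have "expectation (\<lambda>x. V x - (V x)\<^sup>2) \<le> expectation (\<lambda>x. 1 - V x)"
      proof (rule integral_mono_AE)
        show "AE x in M. V x - (V x)\<^sup>2 \<le> 1 - V x"
        proof (rule AE_I2)
          fix x
          have "0 \<le> (1 - V x)\<^sup>2" by simp
          then show "V x - (V x)\<^sup>2 \<le> 1 - V x" by (simp add: power2_eq_square algebra_simps)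
        qed
      qed (use int_V int_VV in auto)
      then show ?thesis using EV1 int_V int_VV by simp
    qed
    \<comment> \<open>Finiteness lets \<open>E[V^2]\<close> be subtracted in the reals instead of in
      \<open>ennreal\<close>.\<close>
    have fin: "(\<integral>\<^sup>+ x. ennreal ((V x)\<^sup>2 * \<bar>Z x\<bar>) \<partial>M) < \<top>"
      using le_less_trans[OF le ennreal_less_top] by (simp add: less_top)
    then obtain s where s: "0 \<le> s" "(\<integral>\<^sup>+ x. ennreal ((V x)\<^sup>2 * \<bar>Z x\<bar>) \<partial>M) = ennreal s"
      by (metis less_top_ennreal)
    have nn: "0 \<le> expectation (\<lambda>x. (V x)\<^sup>2)" by simp
    have nn': "0 \<le> expectation V" using V01 by (intro integral_nonneg_AE) auto
    have "expectation (\<lambda>x. (V x)\<^sup>2) + s \<le> expectation V"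
      using le nn nn' s by (simp flip: ennreal_plus)
    with VV have "s \<le> \<eta>" by simp
    then show ?thesis by (simp add: s ennreal_leI)
  qed
  with that[OF V V01 EV1] show ?thesis by blast
qed

text \<open>The weight is cut at level 1/2: off \<open>B\<close> one has
  \<open>1 <= 2(1 - V)\<close>, and on \<open>B\<close> one has \<open>1 <= 4 V^2\<close>. These
  inequalities produce the factors 2 and 4.\<close>

lemma convex_weight_set:
  fixes K :: "('a \<Rightarrow> real) set"
  assumes "K \<noteq> {}" and "fconvex K" and "K \<subseteq> L0_plus M" and "0 \<le> \<eta>"
    and "\<And>Y. Y \<in> K \<Longrightarrow> L0_dist M Y (\<lambda>_. 0) \<le> ennreal \<eta>"
  obtains B where "B \<in> sets M" "prob (space M - B) \<le> 2 * \<eta>"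
    "\<And>Y. Y \<in> K \<Longrightarrow> (\<integral>\<^sup>+ x. ennreal \<bar>Y x\<bar> * indicator B x \<partial>M) \<le> ennreal (4 * \<eta>)"
proof -
  obtain V where [measurable]: "V \<in> borel_measurable M" and V01: "AE x in M. 0 \<le> V x \<and> V x \<le> 1"
    and EV: "expectation (\<lambda>x. 1 - V x) \<le> \<eta>"
    and K: "\<And>Y. Y \<in> K \<Longrightarrow> (\<integral>\<^sup>+ x. ennreal ((V x)\<^sup>2 * \<bar>Y x\<bar>) \<partial>M) \<le> ennreal \<eta>"
    using convex_weight[OF assms] by blast
  define B where "B = {x \<in> space M. 1/2 \<le> V x}"
  have B[measurable]: "B \<in> sets M" unfolding B_def by measurable
  have int_V: "integrable M V"
    by (rule integrable_const_bound[where B = 1]) (use V01 in auto)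
  show ?thesis
  proof
    show "B \<in> sets M" by (rule B)
    have "prob (space M - B) = expectation (indicator (space M - B))"
      by simp
    also have "\<dots> \<le> expectation (\<lambda>x. 2 * (1 - V x))"
    proof (rule integral_mono_AE)
      show "AE x in M. indicator (space M - B) x \<le> 2 * (1 - V x)"
        using V01 by eventually_elim (auto simp: B_def indicator_def)
      show "integrable M (indicat_real (space M - B))"
        by (rule integrable_const_bound[where B = 1]) auto
    qed (use int_V in auto)
    also have "\<dots> \<le> 2 * \<eta>" using EV int_V by simp
    finally show "prob (space M - B) \<le> 2 * \<eta>" .
    fix Y assume Y: "Y \<in> K"
    then have [measurable]: "Y \<in> borel_measurable M"
      using assms(3) by (auto simp: L0_plus_def)
    have "(\<integral>\<^sup>+ x. ennreal \<bar>Y x\<bar> * indicator B x \<partial>M) \<le> (\<integral>\<^sup>+ x. 4 * ennreal ((V x)\<^sup>2 * \<bar>Y x\<bar>) \<partial>M)"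
    proof (rule nn_integral_mono)
      fix x
      have "\<bar>Y x\<bar> \<le> 4 * ((V x)\<^sup>2 * \<bar>Y x\<bar>)" if "1/2 \<le> V x"
      proof -
        have "(1/2)\<^sup>2 \<le> (V x)\<^sup>2" using that by (intro power_mono) auto
        then have "1 * \<bar>Y x\<bar> \<le> (4 * (V x)\<^sup>2) * \<bar>Y x\<bar>"
          by (intro mult_right_mono) (auto simp: power2_eq_square)
        then show ?thesis by simp
      qed
      then have "ennreal \<bar>Y x\<bar> \<le> ennreal (4 * ((V x)\<^sup>2 * \<bar>Y x\<bar>))" if "1/2 \<le> V x"
        using that by (intro ennreal_leI)
      then show "ennreal \<bar>Y x\<bar> * indicator B x \<le> 4 * ennreal ((V x)\<^sup>2 * \<bar>Y x\<bar>)"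
        by (auto simp: B_def indicator_def ennreal_mult)
    qed
    also have "\<dots> = 4 * (\<integral>\<^sup>+ x. ennreal ((V x)\<^sup>2 * \<bar>Y x\<bar>) \<partial>M)"
      by (rule nn_integral_cmult) measurable
    also have "\<dots> \<le> 4 * ennreal \<eta>" using K[OF Y] by (rule mult_left_mono) simp
    also have "\<dots> = ennreal (4 * \<eta>)" using assms(4) by (simp add: ennreal_mult)
    finally show "(\<integral>\<^sup>+ x. ennreal \<bar>Y x\<bar> * indicator B x \<partial>M) \<le> ennreal (4 * \<eta>)" .
  qed
qed

end

subsection \<open>Absolute continuity and convex combinations\<close>

text \<open>A violating sequence tends to zero in L1 of \<open>M\<close>, so a subsequence tends to
  zero almost everywhere for \<open>M\<close>, hence for \<open>Q\<close>. Domination by 1 then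
  contradicts the lower bound \<open>e\<close>. Functions with values in [0,1] replace sets so that
  the lemma applies directly to \<open>min 1 |X - Y|\<close>.\<close>

lemma nn_integral_abs_continuous:
  assumes "prob_space M" "prob_space Q" "sets Q = sets M"
    and null: "\<And>A. A \<in> sets M \<Longrightarrow> emeasure M A = 0 \<Longrightarrow> emeasure Q A = 0"
    and "0 < (e::ennreal)"
  shows "\<exists>d>0. \<forall>f\<in>borel_measurable M. (\<forall>x. 0 \<le> f x \<and> f x \<le> 1) \<longrightarrow>
    (\<integral>\<^sup>+ x. ennreal (f x) \<partial>M) < d \<longrightarrow> (\<integral>\<^sup>+ x. ennreal (f x) \<partial>Q) < e"
proof (rule ccontr)
  interpret M: prob_space M by fact
  interpret Q: prob_space Q by fact
  have sp: "space Q = space M" using assms(3) by (rule sets_eq_imp_space_eq)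
  assume neg: "\<not> ?thesis"
  have "\<exists>f. f \<in> borel_measurable M \<and> (\<forall>x. 0 \<le> f x \<and> f x \<le> 1) \<and>
      (\<integral>\<^sup>+ x. ennreal (f x) \<partial>M) < d \<and> \<not> (\<integral>\<^sup>+ x. ennreal (f x) \<partial>Q) < e" if "0 < d" for d
    using neg that by blast
  then have "\<exists>f. f \<in> borel_measurable M \<and> (\<forall>x. 0 \<le> f x \<and> f x \<le> 1) \<and>
      (\<integral>\<^sup>+ x. ennreal (f x) \<partial>M) < ennreal (1 / real (Suc n)) \<and> \<not> (\<integral>\<^sup>+ x. ennreal (f x) \<partial>Q) < e" for n
    by simp
  then obtain f :: "nat \<Rightarrow> _ \<Rightarrow> real" where f[measurable]: "\<And>n. f n \<in> borel_measurable M"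
    and f01: "\<And>n x. 0 \<le> f n x \<and> f n x \<le> 1"
    and fM: "\<And>n. (\<integral>\<^sup>+ x. ennreal (f n x) \<partial>M) < ennreal (1 / real (Suc n))"
    and fQ: "\<And>n. \<not> (\<integral>\<^sup>+ x. ennreal (f n x) \<partial>Q) < e"
    by metis
  have int: "integrable M (f n)" for n
    by (rule M.integrable_const_bound[where B = 1]) (use f01 in auto)
  have "(\<lambda>n. \<integral> x. norm (f n x) \<partial>M) \<longlonglongrightarrow> 0"
  proof (rule tendsto_sandwich[OF _ _ tendsto_const LIMSEQ_Suc[OF lim_1_over_n]])
    show "\<forall>\<^sub>F n in sequentially. (\<integral> x. norm (f n x) \<partial>M) \<le> 1 / real (Suc n)"
    proof (rule always_eventually, rule allI)
      fix n
      have "(\<integral>\<^sup>+ x. ennreal (f n x) \<partial>M) = ennreal (\<integral> x. norm (f n x) \<partial>M)"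
        using nn_integral_eq_integral[OF int[of n]] f01 by simp
      with fM[of n] show "(\<integral> x. norm (f n x) \<partial>M) \<le> 1 / real (Suc n)"
        by (metis ennreal_le_iff less_imp_le of_nat_0_le_iff zero_le_divide_1_iff)
    qed
  qed simp
  then obtain r where r: "strict_mono r" "AE x in M. (\<lambda>n. f (r n) x) \<longlonglongrightarrow> 0"
    using tendsto_L1_AE_subseq[of M f] int by blast
  have [measurable]: "f n \<in> borel_measurable Q" for n
    using f[of n] by (simp add: measurable_cong_sets[OF assms(3) refl])
  have "AE x in Q. (\<lambda>n. f (r n) x) \<longlonglongrightarrow> 0"
  proof -
    obtain N where "{x \<in> space M. \<not> ((\<lambda>n. f (r n) x) \<longlonglongrightarrow> 0)} \<subseteq> N" "emeasure M N = 0" "N \<in> sets M"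
      using AE_E[OF r(2)] by blast
    then show ?thesis using null[of N] assms(3) sp by (intro AE_I[where N = N]) auto
  qed
  then have "(\<lambda>n. \<integral>\<^sup>+ x. ennreal (f (r n) x) \<partial>Q) \<longlonglongrightarrow> (\<integral>\<^sup>+ x. 0 \<partial>Q)"
    by (intro nn_integral_dominated_convergence[where w = "\<lambda>_. 1"])
      (use f01 Q.emeasure_space_1 in \<open>auto simp: ennreal_le_1 elim!: eventually_mono intro!: tendsto_ennrealI[where x = 0, simplified]\<close>)
  then have "\<forall>\<^sub>F n in sequentially. (\<integral>\<^sup>+ x. ennreal (f (r n) x) \<partial>Q) < e"
    using \<open>0 < e\<close> by (intro order_tendstoD(2)[where y = 0]) simp_all
  with fQ show False by (simp add: eventually_sequentially)
qed

lemma fconvex_sum_mem: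
  assumes "fconvex U" "finite I" "I \<noteq> {}" "\<And>k. k \<in> I \<Longrightarrow> X k \<in> U"
    and "\<And>k. k \<in> I \<Longrightarrow> 0 \<le> w k" "(\<Sum>k\<in>I. w k) = (1::real)"
  shows "(\<lambda>\<omega>. \<Sum>k\<in>I. w k * X k \<omega>) \<in> U"
  using assms(2-)
proof (induction I arbitrary: w rule: finite_ne_induct)
  case (singleton k)
  then show ?case by simp
next
  case (insert k I)
  define s where "s = (\<Sum>j\<in>I. w j)"
  have ws: "w k = 1 - s" using insert.hyps insert.prems(3) by (simp add: s_def)
  have s: "0 \<le> s" "s \<le> 1"
    using insert.prems(2)[of k] insert.prems(2) ws by (auto simp: s_def intro!: sum_nonneg)
  show ?case
  \<comment> \<open>The old weights are renormalized by their sum \<open>s\<close>; if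
    \<open>s\<close> vanishes, all mass sits on the new point \<open>k\<close>.\<close>
  proof (cases "s = 0")
    case True
    then have "\<forall>j\<in>I. w j = 0"
      using insert.prems(2) insert.hyps by (simp add: s_def sum_nonneg_eq_0_iff)
    then show ?thesis using insert ws True by simp
  next
    case False
    have "(\<lambda>\<omega>. \<Sum>j\<in>I. w j / s * X j \<omega>) \<in> U"
      using insert.prems s False by (intro insert.IH) (auto simp: s_def simp flip: sum_divide_distrib)
    moreover have "X k \<in> U" using insert.prems by simp
    ultimately have "(\<lambda>\<omega>. s * (\<Sum>j\<in>I. w j / s * X j \<omega>) + (1 - s) * X k \<omega>) \<in> U"
      using assms(1) s by (auto simp: fconvex_def)
    also have "(\<lambda>\<omega>. s * (\<Sum>j\<in>I. w j / s * X j \<omega>) + (1 - s) * X k \<omega>) =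
        (\<lambda>\<omega>. \<Sum>j\<in>insert k I. w j * X j \<omega>)"
      using insert.hyps False ws by (simp add: sum_distrib_left add.commute)
    finally show ?thesis .
  qed
qed

text \<open>The convex hull of \<open>S\<close> in the space of functions. Weighted lists allow
  repetitions, so a convex combination of two elements is just the concatenation of the rescaled
  lists.\<close>

definition conv_combs :: "('a \<Rightarrow> real) set \<Rightarrow> ('a \<Rightarrow> real) set" where
  "conv_combs S = {(\<lambda>\<omega>. \<Sum>(w, f)\<leftarrow>xs. w * f \<omega>) | xs.
     (\<forall>(w, f)\<in>set xs. 0 \<le> w \<and> f \<in> S) \<and> sum_list (map fst xs) = 1}"

lemma subset_conv_combs: "S \<subseteq> conv_combs S"
proof
  fix f assume "f \<in> S"
  then show "f \<in> conv_combs S"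
    unfolding conv_combs_def by (intro CollectI exI[of _ "[(1, f)]"]) simp
qed

lemma conv_combsE:
  assumes "Y \<in> conv_combs S"
  obtains n :: nat and w f where "0 < n" "\<And>i. i < n \<Longrightarrow> 0 \<le> w i" "\<And>i. i < n \<Longrightarrow> f i \<in> S"
    "(\<Sum>i<n. w i) = 1" "Y = (\<lambda>\<omega>. \<Sum>i<n. w i * f i \<omega>)"
proof -
  obtain xs where xs: "\<forall>(w, f)\<in>set xs. 0 \<le> w \<and> f \<in> S" "sum_list (map fst xs) = 1"
    "Y = (\<lambda>\<omega>. \<Sum>(w, f)\<leftarrow>xs. w * f \<omega>)"
    using assms by (auto simp: conv_combs_def)
  show ?thesis
  proof
    show "0 < length xs" using xs(2) by auto
    show "0 \<le> fst (xs ! i)" "snd (xs ! i) \<in> S" if "i < length xs" for i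
      using xs(1) nth_mem[OF that] by (auto simp: case_prod_beta)
    show "(\<Sum>i<length xs. fst (xs ! i)) = 1"
      using xs(2) by (simp add: sum_list_sum_nth case_prod_beta atLeast0LessThan)
    show "Y = (\<lambda>\<omega>. \<Sum>i<length xs. fst (xs ! i) * snd (xs ! i) \<omega>)"
      using xs(3) by (simp add: sum_list_sum_nth case_prod_beta atLeast0LessThan)
  qed
qed

lemma fconvex_conv_combs: "fconvex (conv_combs S)"
  unfolding fconvex_def
proof (intro ballI allI impI)
  fix X Y and t :: real
  assume "X \<in> conv_combs S" "Y \<in> conv_combs S" and t: "0 \<le> t \<and> t \<le> 1"
  then obtain xs ys
    where xs: "\<forall>(w, f)\<in>set xs. 0 \<le> w \<and> f \<in> S" "sum_list (map fst xs) = 1"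
      "X = (\<lambda>\<omega>. \<Sum>(w, f)\<leftarrow>xs. w * f \<omega>)"
    and ys: "\<forall>(w, f)\<in>set ys. 0 \<le> w \<and> f \<in> S" "sum_list (map fst ys) = 1"
      "Y = (\<lambda>\<omega>. \<Sum>(w, f)\<leftarrow>ys. w * f \<omega>)"
    by (auto simp: conv_combs_def)
  define zs where "zs = map (\<lambda>(w, f). (t * w, f)) xs @ map (\<lambda>(w, f). ((1 - t) * w, f)) ys"
  show "(\<lambda>\<omega>. t * X \<omega> + (1 - t) * Y \<omega>) \<in> conv_combs S"
    unfolding conv_combs_def
  proof (intro CollectI exI[of _ zs] conjI)
    show "\<forall>(w, f)\<in>set zs. 0 \<le> w \<and> f \<in> S"
      using xs(1) ys(1) t by (auto simp: zs_def)
    show "sum_list (map fst zs) = 1"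
      using xs(2) ys(2) by (simp add: zs_def o_def case_prod_beta sum_list_const_mult)
    show "(\<lambda>\<omega>. t * X \<omega> + (1 - t) * Y \<omega>) = (\<lambda>\<omega>. \<Sum>(w, f)\<leftarrow>zs. w * f \<omega>)"
      by (simp add: xs(3) ys(3) zs_def o_def case_prod_unfold mult.assoc sum_list_const_mult)
  qed
qed

lemma conv_combs_subset:
  assumes "fconvex U" "S \<subseteq> U"
  shows "conv_combs S \<subseteq> U"
proof
  fix Y assume "Y \<in> conv_combs S"
  then obtain n :: nat and w f where *: "0 < n" "\<And>i. i < n \<Longrightarrow> 0 \<le> w i" "\<And>i. i < n \<Longrightarrow> f i \<in> S"
    "(\<Sum>i<n. w i) = 1" "Y = (\<lambda>\<omega>. \<Sum>i<n. w i * f i \<omega>)"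
    by (rule conv_combsE) blast
  then show "Y \<in> U"
    using fconvex_sum_mem[OF assms(1), of "{..<n}" f w] assms(2) by auto
qed

subsection \<open>Tails and forward convex combinations\<close>

text \<open>For \<open>X\<close> in \<open>L0_plus\<close> this agrees almost everywhere with the
  tail integrand of \<open>unif_integrable\<close>. Truncating without absolute values also makes it
  nonnegative everywhere.\<close>

definition upper_tail :: "nat \<Rightarrow> ('a \<Rightarrow> real) \<Rightarrow> 'a \<Rightarrow> real" where
  "upper_tail m X = (\<lambda>\<omega>. X \<omega> * indicator {\<omega>. X \<omega> > real m} \<omega>)"

lemma borel_measurable_upper_tail[measurable (raw)]:
  "X \<in> borel_measurable M \<Longrightarrow> upper_tail m X \<in> borel_measurable M"
proof -
  assume [measurable]: "X \<in> borel_measurable M"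
  have "upper_tail m X = (\<lambda>\<omega>. if X \<omega> > real m then X \<omega> else 0)"
    by (auto simp: upper_tail_def)
  then show ?thesis by simp
qed

lemma solid_zero: "solid M C \<Longrightarrow> C \<subseteq> L0_plus M \<Longrightarrow> C \<noteq> {} \<Longrightarrow> (\<lambda>_. 0) \<in> C"
  unfolding solid_def L0_plus_def by auto

lemma solid_upper_tail:
  assumes "solid M C" "C \<subseteq> L0_plus M" "X \<in> C"
  shows "upper_tail m X \<in> C"
proof -
  have X[measurable]: "X \<in> borel_measurable M" and pos: "AE \<omega> in M. 0 \<le> X \<omega>"
    using assms by (auto simp: L0_plus_def)
  have "AE \<omega> in M. 0 \<le> upper_tail m X \<omega> \<and> upper_tail m X \<omega> \<le> X \<omega>"
    using pos by eventually_elim (auto simp: upper_tail_def indicator_def)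
  then have "upper_tail m X \<in> L0_plus M" "AE \<omega> in M. upper_tail m X \<omega> \<le> X \<omega>"
    by (auto simp: L0_plus_def)
  then show ?thesis using assms by (auto simp: solid_def)
qed

lemma L0_dist_upper_tail:
  assumes [measurable]: "X \<in> borel_measurable M"
  shows "L0_dist M (upper_tail m X) (\<lambda>_. 0) \<le> emeasure M {\<omega>\<in>space M. \<bar>X \<omega>\<bar> > real m}"
proof -
  have "L0_dist M (upper_tail m X) (\<lambda>_. 0) \<le> (\<integral>\<^sup>+ \<omega>. indicator {\<omega>\<in>space M. \<bar>X \<omega>\<bar> > real m} \<omega> \<partial>M)"
    unfolding L0_dist_def
    by (intro nn_integral_mono) (auto simp: upper_tail_def indicator_def ennreal_le_1)
  also have "\<dots> = emeasure M {\<omega>\<in>space M. \<bar>X \<omega>\<bar> > real m}"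
    by (intro nn_integral_indicator) measurable
  finally show ?thesis .
qed

text \<open>If the convex combinations of the tails \<open>X 1\<^bsub>{X > m}\<^esub>\<close> did not become uniformly small,
  choosing one bad combination for each \<open>m\<close> and listing all the tails occurring in them
  (by \<open>prod_encode\<close>, which satisfies \<open>m \<le> prod_encode (m, i)\<close>) would give a null sequence
  with bad forward convex combinations.\<close>

lemma small_conv_combs_upper_tails:
  fixes C :: "('a \<Rightarrow> real) set"
  assumes C: "C \<subseteq> L0_plus M" "solid M C" "L0_bounded M C"
    and forward: "\<And>X Y. (\<And>n. X n \<in> C) \<Longrightarrow> (\<lambda>n. L0_dist M (X n) (\<lambda>_. 0)) \<longlonglongrightarrow> 0 \<Longrightarrow>
      forward_convex_comb X Y \<Longrightarrow> (\<lambda>n. L0_dist M (Y n) (\<lambda>_. 0)) \<longlonglongrightarrow> 0"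
    and "C \<noteq> {}" and "0 < e"
  shows "\<exists>m. \<forall>Y\<in>conv_combs (upper_tail m ` C). L0_dist M Y (\<lambda>_. 0) \<le> e"
proof (rule ccontr)
  assume "\<not> ?thesis"
  then have "\<exists>Y. Y \<in> conv_combs (upper_tail m ` C) \<and> e < L0_dist M Y (\<lambda>_. 0)" for m
    by (auto simp: not_le)
  then obtain Y where Y: "\<And>m. Y m \<in> conv_combs (upper_tail m ` C)"
    and bad: "\<And>m. e < L0_dist M (Y m) (\<lambda>_. 0)"
    by metis
  have "\<forall>m. \<exists>(n::nat) w f. 0 < n \<and> (\<forall>i<n. 0 \<le> w i) \<and> (\<forall>i<n. f i \<in> upper_tail m ` C) \<and>
      (\<Sum>i<n. w i) = 1 \<and> Y m = (\<lambda>\<omega>. \<Sum>i<n. w i * f i \<omega>)"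
    by (rule allI, rule conv_combsE[OF Y]) (intro exI conjI allI impI; assumption)
  then have "\<exists>(N :: nat \<Rightarrow> nat) w f. \<forall>m. 0 < N m \<and> (\<forall>i<N m. 0 \<le> w m i) \<and>
      (\<forall>i<N m. f m i \<in> upper_tail m ` C) \<and> (\<Sum>i<N m. w m i) = 1 \<and>
      Y m = (\<lambda>\<omega>. \<Sum>i<N m. w m i * f m i \<omega>)"
    by (simp only: choice_iff)
  then obtain N :: "nat \<Rightarrow> nat" and w f
    where Nwf: "\<forall>m. 0 < N m \<and> (\<forall>i<N m. 0 \<le> w m i) \<and>
      (\<forall>i<N m. f m i \<in> upper_tail m ` C) \<and> (\<Sum>i<N m. w m i) = 1 \<and>
      Y m = (\<lambda>\<omega>. \<Sum>i<N m. w m i * f m i \<omega>)"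
    by (elim exE)
  have N: "\<And>m. 0 < N m" and w: "\<And>m i. i < N m \<Longrightarrow> 0 \<le> w m i"
    and f: "\<And>m i. i < N m \<Longrightarrow> f m i \<in> upper_tail m ` C"
    and sum1: "\<And>m. (\<Sum>i<N m. w m i) = 1"
    and Yeq: "\<And>m. Y m = (\<lambda>\<omega>. \<Sum>i<N m. w m i * f m i \<omega>)"
    using Nwf by blast+
  \<comment> \<open>Row \<open>m\<close> of the enumeration holds the tails used in
    \<open>Y m\<close>. Codes outside the rows are filled with 0, which belongs to \<open>C\<close>
    and does not disturb convergence.\<close>
  define X where "X k = (case prod_decode k of (m, i) \<Rightarrow> if i < N m then f m i else (\<lambda>_. 0))" for k
  define W where "W k = (case prod_decode k of (m, i) \<Rightarrow> w m i)" for k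
  define s where "s m = (SUP X\<in>C. emeasure M {\<omega>\<in>space M. \<bar>X \<omega>\<bar> > real m})" for m :: nat
  have fC: "f m i \<in> C" if "i < N m" for m i
    using f[OF that] solid_upper_tail[OF C(2,1)] by auto
  have XC: "X k \<in> C" for k
    using fC solid_zero[OF C(2,1) \<open>C \<noteq> {}\<close>] by (auto simp: X_def split: prod.split)
  have fs: "L0_dist M (f m i) (\<lambda>_. 0) \<le> s m" if "i < N m" for m i
  proof -
    obtain Z where Z: "Z \<in> C" "f m i = upper_tail m Z" using f[OF \<open>i < N m\<close>] by auto
    have "L0_dist M (f m i) (\<lambda>_. 0) \<le> emeasure M {\<omega>\<in>space M. \<bar>Z \<omega>\<bar> > real m}"
      unfolding Z(2) using Z(1) C(1) by (intro L0_dist_upper_tail) (auto simp: L0_plus_def)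
    also have "\<dots> \<le> s m" unfolding s_def using Z(1) by (rule SUP_upper)
    finally show ?thesis .
  qed
  have "(\<lambda>k. L0_dist M (X k) (\<lambda>_. 0)) \<longlonglongrightarrow> 0"
  proof (rule order_tendstoI)
    fix d :: ennreal assume "0 < d"
    then have "\<forall>\<^sub>F m in sequentially. s m < d"
      using C(3) unfolding L0_bounded_def s_def by (rule order_tendstoD(2)[rotated])
    then obtain m0 where m0: "\<And>m. m \<ge> m0 \<Longrightarrow> s m < d" by (auto simp: eventually_sequentially)
    \<comment> \<open>All entries of row \<open>m\<close> are within \<open>s m\<close> of zero and
      \<open>s m\<close> tends to 0, so only the finitely many entries of the rows below
      \<open>m0\<close> can be at distance \<open>d\<close> or more.\<close>
    have "{k. \<not> L0_dist M (X k) (\<lambda>_. 0) < d} \<subseteq> prod_encode ` (SIGMA m:{..<m0}. {..<N m})"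
    proof
      fix k assume k: "k \<in> {k. \<not> L0_dist M (X k) (\<lambda>_. 0) < d}"
      obtain m i where mi: "k = prod_encode (m, i)" by (metis prod_decode_inverse surj_pair)
      have "i < N m"
        using k mi \<open>0 < d\<close> by (cases "i < N m") (auto simp: X_def L0_dist_def)
      then have "\<not> s m < d" using k mi fs[of i m] by (auto simp: X_def)
      then have "m < m0" using m0 by (meson not_le)
      with \<open>i < N m\<close> mi show "k \<in> prod_encode ` (SIGMA m:{..<m0}. {..<N m})" by auto
    qed
    then have "finite {k. \<not> L0_dist M (X k) (\<lambda>_. 0) < d}"
      by (rule finite_subset) auto
    then show "\<forall>\<^sub>F k in sequentially. L0_dist M (X k) (\<lambda>_. 0) < d"
      by (simp add: cofinite_eq_sequentially[symmetric] eventually_cofinite)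
  qed simp
  moreover have "forward_convex_comb X Y"
    unfolding forward_convex_comb_def
  proof
    fix m
    define I where "I = (\<lambda>i. prod_encode (m, i)) ` {..<N m}"
    have inj: "inj_on (\<lambda>i. prod_encode (m, i)) {..<N m}" by (auto simp: inj_on_def prod_encode_eq)
    show "\<exists>I w. finite I \<and> I \<noteq> {} \<and> I \<subseteq> {m..} \<and> (\<forall>k\<in>I. 0 \<le> w k) \<and>
        (\<Sum>k\<in>I. w k) = (1::real) \<and> Y m = (\<lambda>\<omega>. \<Sum>k\<in>I. w k * X k \<omega>)"
    proof (intro exI[of _ I] exI[of _ W] conjI)
      show "finite I" by (simp add: I_def)
      show "I \<noteq> {}" using N[of m] by (auto simp: I_def)
      show "I \<subseteq> {m..}" using le_prod_encode_1 by (auto simp: I_def)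
      show "\<forall>k\<in>I. 0 \<le> W k" using w by (auto simp: I_def W_def)
      show "(\<Sum>k\<in>I. W k) = 1"
        using sum1[of m] by (simp add: I_def sum.reindex[OF inj] W_def)
      show "Y m = (\<lambda>\<omega>. \<Sum>k\<in>I. W k * X k \<omega>)"
        by (simp add: I_def sum.reindex[OF inj] W_def X_def Yeq)
    qed
  qed
  ultimately have "(\<lambda>n. L0_dist M (Y n) (\<lambda>_. 0)) \<longlonglongrightarrow> 0"
    using forward XC by blast
  then have "\<forall>\<^sub>F n in sequentially. L0_dist M (Y n) (\<lambda>_. 0) < e"
    using \<open>0 < e\<close> by (rule order_tendstoD(2))
  then obtain n where "L0_dist M (Y n) (\<lambda>_. 0) < e"
    by (auto simp: eventually_sequentially)
  with bad[of n] show False by simp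
qed

section \<open>Convex neighbourhood bases: what they imply and where they come from\<close>

text \<open>A convex neighbourhood of 0 inside a given ball eventually contains all
  \<open>X n\<close>, and with them every convex combination of the later terms.\<close>

lemma forward_convex_comb_null:
  assumes base: "convex_nhd_base M C (\<lambda>_. 0)"
    and X: "\<And>n. X n \<in> C" "(\<lambda>n. L0_dist M (X n) (\<lambda>_. 0)) \<longlonglongrightarrow> 0"
    and Y: "forward_convex_comb X Y"
  shows "(\<lambda>n. L0_dist M (Y n) (\<lambda>_. 0)) \<longlonglongrightarrow> 0"
proof (rule order_tendstoI)
  have sym0: "L0_dist M (\<lambda>_. 0) Z = L0_dist M Z (\<lambda>_. 0)" for Z
    by (simp add: L0_dist_def)
  fix e :: ennreal assume "0 < e"
  then have "rel_nhd (L0_dist M) C (\<lambda>_. 0) {Z\<in>C. L0_dist M (\<lambda>_. 0) Z < e}"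
    unfolding rel_nhd_def by blast
  then obtain U where U: "rel_nhd (L0_dist M) C (\<lambda>_. 0) U" "fconvex U"
    "U \<subseteq> {Z\<in>C. L0_dist M (\<lambda>_. 0) Z < e}"
    using base unfolding convex_nhd_base_def by blast
  then obtain d where d: "0 < d" "{Z\<in>C. L0_dist M (\<lambda>_. 0) Z < d} \<subseteq> U"
    unfolding rel_nhd_def by blast
  have "\<forall>\<^sub>F n in sequentially. L0_dist M (X n) (\<lambda>_. 0) < d"
    using X(2) d(1) by (rule order_tendstoD(2))
  then obtain n0 where "\<And>n. n \<ge> n0 \<Longrightarrow> L0_dist M (X n) (\<lambda>_. 0) < d"
    by (auto simp: eventually_sequentially)
  then have n0: "X n \<in> U" if "n \<ge> n0" for n
    using d(2) X(1)[of n] that by (simp add: subset_iff sym0)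
  have "L0_dist M (Y n) (\<lambda>_. 0) < e" if n: "n \<ge> n0" for n
  proof -
    obtain I w where I: "finite I" "I \<noteq> {}" "I \<subseteq> {n..}" "\<forall>k\<in>I. 0 \<le> w k"
      "(\<Sum>k\<in>I. w k) = (1::real)" "Y n = (\<lambda>\<omega>. \<Sum>k\<in>I. w k * X k \<omega>)"
      using Y[unfolded forward_convex_comb_def, THEN spec, of n] by (elim exE conjE)
    have "Y n \<in> U"
      unfolding I(6)
    proof (rule fconvex_sum_mem[OF U(2) I(1,2)])
      show "X k \<in> U" if "k \<in> I" for k using I(3) n that by (intro n0) auto
    qed (use I(4,5) in auto)
    with U(3) show ?thesis by (auto simp: sym0)
  qed
  then show "\<forall>\<^sub>F n in sequentially. L0_dist M (Y n) (\<lambda>_. 0) < e"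
    by (auto simp: eventually_sequentially)
qed simp

text \<open>Balls of a norm are convex, so once the topologies agree at \<open>X\<close> the L1
  balls intersected with the convex set \<open>C\<close> serve as the base.\<close>

lemma convex_nhd_base_if_L1_topology:
  assumes C: "C \<subseteq> L0_plus M" "fconvex C" and Q: "sets Q = sets M" and X: "X \<in> C"
    and top: "\<And>U. rel_nhd (L0_dist M) C X U \<longleftrightarrow> rel_nhd (L1_dist Q) C X U"
  shows "convex_nhd_base M C X"
  unfolding convex_nhd_base_def
proof (intro allI impI)
  have [measurable]: "Z \<in> borel_measurable Q" if "Z \<in> C" for Z
    using C(1) that by (auto simp: L0_plus_def measurable_cong_sets[OF Q refl])
  fix V assume "rel_nhd (L0_dist M) C X V"
  then have "rel_nhd (L1_dist Q) C X V" using top by simp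
  then obtain d where d: "0 < d" "{Z\<in>C. L1_dist Q X Z < d} \<subseteq> V"
    unfolding rel_nhd_def by blast
  define U where "U = {Z\<in>C. L1_dist Q X Z < d}"
  have "rel_nhd (L1_dist Q) C X U" using d(1) unfolding rel_nhd_def U_def by blast
  moreover have "fconvex U"
    unfolding fconvex_def
  proof (intro ballI allI impI)
    fix Y Z and t :: real assume YZ: "Y \<in> U" "Z \<in> U" and t: "0 \<le> t \<and> t \<le> 1"
    then have in_C: "Y \<in> C" "Z \<in> C" by (auto simp: U_def)
    have [measurable]: "X \<in> borel_measurable Q" "Y \<in> borel_measurable Q" "Z \<in> borel_measurable Q"
      using in_C X by auto
    define W where "W = (\<lambda>\<omega>. t * Y \<omega> + (1 - t) * Z \<omega>)"
    have "L1_dist Q X W \<le>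
        (\<integral>\<^sup>+ \<omega>. ennreal t * ennreal \<bar>X \<omega> - Y \<omega>\<bar> + ennreal (1 - t) * ennreal \<bar>X \<omega> - Z \<omega>\<bar> \<partial>Q)"
      unfolding L1_dist_def
    proof (rule nn_integral_mono)
      fix \<omega>
      have "\<bar>X \<omega> - W \<omega>\<bar> = \<bar>t * (X \<omega> - Y \<omega>) + (1 - t) * (X \<omega> - Z \<omega>)\<bar>"
        by (simp add: W_def algebra_simps)
      also have "\<dots> \<le> t * \<bar>X \<omega> - Y \<omega>\<bar> + (1 - t) * \<bar>X \<omega> - Z \<omega>\<bar>"
        using t by (intro order_trans[OF abs_triangle_ineq]) (simp add: abs_mult)
      finally show "ennreal \<bar>X \<omega> - W \<omega>\<bar> \<le>
          ennreal t * ennreal \<bar>X \<omega> - Y \<omega>\<bar> + ennreal (1 - t) * ennreal \<bar>X \<omega> - Z \<omega>\<bar>"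
        using t by (simp add: ennreal_leI flip: ennreal_mult ennreal_plus)
    qed
    also have "\<dots> = ennreal t * L1_dist Q X Y + ennreal (1 - t) * L1_dist Q X Z"
      unfolding L1_dist_def by (simp add: nn_integral_add nn_integral_cmult)
    \<comment> \<open>Passing to the maximum keeps the final inequality strict also for
      \<open>t = 0\<close> and \<open>t = 1\<close>.\<close>
    also have "\<dots> \<le> ennreal t * max (L1_dist Q X Y) (L1_dist Q X Z) +
        ennreal (1 - t) * max (L1_dist Q X Y) (L1_dist Q X Z)"
      by (intro add_mono mult_left_mono) auto
    also have "\<dots> = max (L1_dist Q X Y) (L1_dist Q X Z)"
      using t by (simp flip: distrib_right ennreal_plus)
    also have "\<dots> < d" using YZ by (auto simp: U_def)
    finally have "L1_dist Q X W < d" .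
    moreover have "W \<in> C" unfolding W_def using C(2) in_C t by (auto simp: fconvex_def)
    ultimately show "(\<lambda>\<omega>. t * Y \<omega> + (1 - t) * Z \<omega>) \<in> U"
      by (simp add: U_def W_def)
  qed
  ultimately show "\<exists>U. rel_nhd (L0_dist M) C X U \<and> fconvex U \<and> U \<subseteq> V"
    using top d(2) by (intro exI[of _ U]) (auto simp: U_def)
qed

subsection \<open>Change of measure\<close>

lemma fconvex_L0_plus: "fconvex (L0_plus M)"
  unfolding fconvex_def
proof (intro ballI allI impI)
  fix X Y and t :: real
  assume XY: "X \<in> L0_plus M" "Y \<in> L0_plus M" and t: "0 \<le> t \<and> t \<le> 1"
  then have "AE \<omega> in M. 0 \<le> X \<omega>" "AE \<omega> in M. 0 \<le> Y \<omega>" by (auto simp: L0_plus_def)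
  then have "AE \<omega> in M. 0 \<le> t * X \<omega> + (1 - t) * Y \<omega>"
    by eventually_elim (use t in simp)
  moreover have [measurable]: "X \<in> borel_measurable M" "Y \<in> borel_measurable M"
    using XY by (auto simp: L0_plus_def)
  ultimately show "(\<lambda>\<omega>. t * X \<omega> + (1 - t) * Y \<omega>) \<in> L0_plus M"
    unfolding L0_plus_def by simp
qed

text \<open>Dividing \<open>D\<close> by its total mass \<open>c\<close> gives mass one. Almost sure
  positivity of \<open>D\<close> makes \<open>c\<close> nonzero and gives the density the same null
  sets as \<open>M\<close>.\<close>

lemma equiv_prob_density:
  assumes "prob_space M" and [measurable]: "D \<in> borel_measurable M"
    and D: "AE x in M. D x \<noteq> 0" "(\<integral>\<^sup>+ x. D x \<partial>M) \<noteq> \<infinity>"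
  obtains c where "0 < c" "equiv_prob M (density M (\<lambda>x. D x / ennreal c))"
proof -
  interpret prob_space M by fact
  have "(\<integral>\<^sup>+ x. D x \<partial>M) \<noteq> 0"
  proof
    assume "(\<integral>\<^sup>+ x. D x \<partial>M) = 0"
    then have "AE x in M. D x = 0" by (simp add: nn_integral_0_iff_AE)
    with D(1) have "AE x in M. False" by eventually_elim simp
    then show False by simp
  qed
  with D(2) obtain c where c: "(\<integral>\<^sup>+ x. D x \<partial>M) = ennreal c" "0 < c"
    by (cases "\<integral>\<^sup>+ x. D x \<partial>M") (auto simp: less_le)
  let ?Q = "density M (\<lambda>x. D x / ennreal c)"
  have "prob_space ?Q"
  proof
    have "emeasure ?Q (space ?Q) = (\<integral>\<^sup>+ x. D x / ennreal c \<partial>M)"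
      by (simp add: emeasure_density cong: nn_integral_cong)
    also have "\<dots> = 1"
      using c by (simp add: nn_integral_divide ennreal_divide_self)
    finally show "emeasure ?Q (space ?Q) = 1" .
  qed
  moreover have "emeasure M A = 0 \<longleftrightarrow> emeasure ?Q A = 0" if A: "A \<in> sets M" for A
  proof -
    have "emeasure ?Q A = 0 \<longleftrightarrow> A \<in> null_sets ?Q"
      using A by (simp add: null_sets_def)
    also have "\<dots> \<longleftrightarrow> (AE x in M. x \<in> A \<longrightarrow> D x / ennreal c = 0)"
      using A by (simp add: null_sets_density_iff)
    also have "\<dots> \<longleftrightarrow> (AE x in M. x \<notin> A)"
    proof
      assume "AE x in M. x \<in> A \<longrightarrow> D x / ennreal c = 0"
      with D(1) show "AE x in M. x \<notin> A"
        by eventually_elim (use c in \<open>auto simp: ennreal_divide_eq_0_iff\<close>)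
    qed (auto elim: eventually_mono)
    also have "\<dots> \<longleftrightarrow> emeasure M A = 0"
      using A by (simp add: AE_iff_measurable[OF A] sets.sets_into_space Int_absorb1 flip: Int_def)
    finally show ?thesis ..
  qed
  ultimately have "equiv_prob M ?Q" by (simp add: equiv_prob_def)
  with c(2) that show ?thesis by blast
qed

text \<open>The density is a mixture of the indicators of the sets \<open>A j\<close>. On
  \<open>A j\<close> the tails at level \<open>m k\<close> are controlled only for
  \<open>k >= j\<close>; the smallness of \<open>c j\<close> compensates for the levels
  \<open>k < j\<close>.\<close>

lemma unif_integrable_if_small_conv_combs:
  fixes C :: "('a \<Rightarrow> real) set"
  assumes M: "prob_space M" and C: "C \<subseteq> L0_plus M" "solid M C" "C \<noteq> {}"
    and small: "\<And>e. 0 < e \<Longrightarrow> \<exists>m. \<forall>Y\<in>conv_combs (upper_tail m ` C). L0_dist M Y (\<lambda>_. 0) \<le> e"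
  shows "\<exists>Q. equiv_prob M Q \<and> unif_integrable Q C"
proof -
  interpret prob_space M by fact
  have meas[measurable]: "X \<in> borel_measurable M" if "X \<in> C" for X
    using that C(1) by (auto simp: L0_plus_def)
  have pos: "AE x in M. 0 \<le> X x" if "X \<in> C" for X
    using that C(1) by (auto simp: L0_plus_def)
  have "\<exists>m. \<forall>Y\<in>conv_combs (upper_tail m ` C). L0_dist M Y (\<lambda>_. 0) \<le> ennreal ((1/2) ^ k)" for k
    by (rule small) simp
  then obtain m where m: "\<And>k Y. Y \<in> conv_combs (upper_tail (m k) ` C) \<Longrightarrow>
      L0_dist M Y (\<lambda>_. 0) \<le> ennreal ((1/2) ^ k)"
    by metis
  have "\<exists>B\<in>sets M. prob (space M - B) \<le> 2 * (1/2) ^ k \<and> (\<forall>Y\<in>conv_combs (upper_tail (m k) ` C).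
      (\<integral>\<^sup>+ x. ennreal \<bar>Y x\<bar> * indicator B x \<partial>M) \<le> ennreal (4 * (1/2) ^ k))" for k
  proof (rule convex_weight_set[OF _ fconvex_conv_combs _ _ m])
    show "conv_combs (upper_tail (m k) ` C) \<noteq> {}"
      using C(3) subset_conv_combs[of "upper_tail (m k) ` C"] by auto
    show "conv_combs (upper_tail (m k) ` C) \<subseteq> L0_plus M"
      using solid_upper_tail[OF C(2,1)] C(1) by (intro conv_combs_subset fconvex_L0_plus) blast
  qed auto
  then obtain B where B[measurable]: "\<And>k. B k \<in> sets M"
    and probB: "\<And>k. prob (space M - B k) \<le> 2 * (1/2) ^ k"
    and intB: "\<And>k Y. Y \<in> conv_combs (upper_tail (m k) ` C) \<Longrightarrow>
      (\<integral>\<^sup>+ x. ennreal \<bar>Y x\<bar> * indicator (B k) x \<partial>M) \<le> ennreal (4 * (1/2) ^ k)"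
    by metis
  define A where "A j = (\<Inter>k\<in>{j..}. B k)" for j
  have [measurable]: "A j \<in> sets M" for j
    unfolding A_def by (intro sets.countable_INT) auto
  have intA: "(\<integral>\<^sup>+ x. ennreal \<bar>upper_tail (m k) X x\<bar> * indicator (A j) x \<partial>M) \<le> ennreal (4 * (1/2) ^ k)"
    if "X \<in> C" "j \<le> k" for X j k
  proof -
    have "(\<integral>\<^sup>+ x. ennreal \<bar>upper_tail (m k) X x\<bar> * indicator (A j) x \<partial>M) \<le>
        (\<integral>\<^sup>+ x. ennreal \<bar>upper_tail (m k) X x\<bar> * indicator (B k) x \<partial>M)"
      using that(2) by (intro nn_integral_mono) (auto simp: A_def indicator_def)
    also have "\<dots> \<le> ennreal (4 * (1/2) ^ k)"
      by (intro intB subsetD[OF subset_conv_combs] imageI that(1))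
    finally show ?thesis .
  qed
  \<comment> \<open>\<open>m j + 4\<close> bounds \<open>E[X 1\<^bsub>A j\<^esub>]\<close> uniformly in \<open>X \<in> C\<close>\<close>
  define c where "c j = (1/4) ^ j / (real (m j) + 4)" for j
  have c0: "0 < c j" for j by (simp add: c_def add_nonneg_pos)
  have c_le: "c j * 4 \<le> (1/4) ^ j" for j
    using mult_left_mono[of "4 / (real (m j) + 4)" 1 "(1/4) ^ j"] by (simp add: c_def)
  define D where "D x = (\<Sum>j. ennreal (c j) * indicator (A j) x)" for x
  have [measurable]: "D \<in> borel_measurable M" unfolding D_def by measurable
  have quarter: "(1/4) ^ j = (1/2) ^ j * (1/2 :: real) ^ j" for j
    by (simp flip: power_mult_distrib)
  \<comment> \<open>The factor in \<open>j\<close> makes the series defining the density summable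
    against the tail; the factor in \<open>k\<close> survives as the decay of the tails.\<close>
  have term_le: "ennreal (c j) * (\<integral>\<^sup>+ x. ennreal \<bar>upper_tail (m k) X x\<bar> * indicator (A j) x \<partial>M)
      \<le> ennreal ((1/2) ^ k * (1/2) ^ j)" if X: "X \<in> C" for X j k
  proof (cases "j \<le> k")
    case True
    have "ennreal (c j) * (\<integral>\<^sup>+ x. ennreal \<bar>upper_tail (m k) X x\<bar> * indicator (A j) x \<partial>M)
        \<le> ennreal (c j) * ennreal (4 * (1/2) ^ k)"
      by (intro mult_left_mono intA X True) simp
    also have "\<dots> = ennreal (c j * (4 * (1/2) ^ k))" using c0[of j] by (simp add: ennreal_mult)
    also have "\<dots> \<le> ennreal ((1/2) ^ k * (1/2) ^ j)"
    proof (rule ennreal_leI)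
      have "c j * 4 \<le> (1/4) ^ j" by (rule c_le)
      also have "\<dots> \<le> (1/2) ^ j" by (intro power_mono) auto
      finally show "c j * (4 * (1/2) ^ k) \<le> (1/2) ^ k * (1/2) ^ j"
        using mult_right_mono[of "c j * 4" "(1/2) ^ j" "(1/2) ^ k"] by (simp add: ac_simps)
    qed
    finally show ?thesis .
  next
    case False
    note [measurable] = meas[OF X]
    \<comment> \<open>Here \<open>k < j\<close>, so \<open>intA\<close> is applied at level
      \<open>j\<close> instead: any tail is at most \<open>X\<close>, and \<open>X\<close> is at
      most \<open>m j\<close> plus its tail beyond \<open>m j\<close>. This comparison holds
      whatever the order of \<open>m k\<close> and \<open>m j\<close>. The spare factor in
      \<open>(1/4)^j\<close> then pays for \<open>(1/2)^k\<close>.\<close>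
    have "(\<integral>\<^sup>+ x. ennreal \<bar>upper_tail (m k) X x\<bar> * indicator (A j) x \<partial>M) \<le>
        (\<integral>\<^sup>+ x. ennreal (real (m j)) + ennreal \<bar>upper_tail (m j) X x\<bar> * indicator (A j) x \<partial>M)"
    proof (rule nn_integral_mono_AE)
      show "AE x in M. ennreal \<bar>upper_tail (m k) X x\<bar> * indicator (A j) x \<le>
          ennreal (real (m j)) + ennreal \<bar>upper_tail (m j) X x\<bar> * indicator (A j) x"
        using pos[OF X]
      proof eventually_elim
        case (elim x)
        then have "\<bar>upper_tail (m k) X x\<bar> \<le> real (m j) + \<bar>upper_tail (m j) X x\<bar>"
          by (auto simp: upper_tail_def indicator_def)
        then have "ennreal \<bar>upper_tail (m k) X x\<bar> \<le> ennreal (real (m j)) + ennreal \<bar>upper_tail (m j) X x\<bar>"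
          by (simp add: ennreal_leI flip: ennreal_plus)
        then show ?case by (auto simp: indicator_def)
      qed
    qed
    also have "\<dots> = ennreal (real (m j)) + (\<integral>\<^sup>+ x. ennreal \<bar>upper_tail (m j) X x\<bar> * indicator (A j) x \<partial>M)"
      by (subst nn_integral_add) (auto simp: emeasure_space_1)
    also have "\<dots> \<le> ennreal (real (m j)) + ennreal (4 * (1/2) ^ j)"
      by (intro add_left_mono intA X) simp
    also have "\<dots> \<le> ennreal (real (m j) + 4)"
    proof -
      have "real (m j) + 4 * (1/2) ^ j \<le> real (m j) + 4" by (simp add: power_le_one)
      then show ?thesis by (subst ennreal_plus[symmetric]) (auto intro: ennreal_leI simp del: ennreal_plus)
    qed
    finally have "ennreal (c j) * (\<integral>\<^sup>+ x. ennreal \<bar>upper_tail (m k) X x\<bar> * indicator (A j) x \<partial>M)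
        \<le> ennreal (c j) * ennreal (real (m j) + 4)"
      by (rule mult_left_mono) simp
    also have "\<dots> = ennreal (c j * (real (m j) + 4))"
      using c0[of j] by (simp add: ennreal_mult)
    also have "c j * (real (m j) + 4) = (1/4) ^ j"
      by (simp add: c_def)
    also have "ennreal ((1/4) ^ j) \<le> ennreal ((1/2) ^ k * (1/2) ^ j)"
      unfolding quarter using False
      by (intro ennreal_leI mult_right_mono power_decreasing) auto
    finally show ?thesis .
  qed
  have geo: "(\<Sum>j. ennreal (a * (1/2) ^ j)) = ennreal (2 * a)" if "0 \<le> a" for a :: real
  proof -
    have "(\<lambda>j. a * (1/2) ^ j) sums (a * 2)"
      using sums_mult[OF geometric_sums[of "1/2::real"], of a] by simp
    then show ?thesis
      using that by (subst suminf_ennreal_eq) (auto simp: mult.commute)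
  qed
  have tailD: "(\<integral>\<^sup>+ x. D x * ennreal \<bar>upper_tail (m k) X x\<bar> \<partial>M) \<le> ennreal (2 * (1/2) ^ k)"
    if X: "X \<in> C" for X k
  proof -
    note [measurable] = meas[OF X]
    have "(\<integral>\<^sup>+ x. D x * ennreal \<bar>upper_tail (m k) X x\<bar> \<partial>M) =
        (\<integral>\<^sup>+ x. (\<Sum>j. ennreal (c j) * (ennreal \<bar>upper_tail (m k) X x\<bar> * indicator (A j) x)) \<partial>M)"
      by (intro nn_integral_cong) (simp add: D_def ac_simps flip: ennreal_suminf_multc ennreal_suminf_cmult)
    also have "\<dots> = (\<Sum>j. ennreal (c j) * (\<integral>\<^sup>+ x. ennreal \<bar>upper_tail (m k) X x\<bar> * indicator (A j) x \<partial>M))"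
      by (simp add: nn_integral_suminf nn_integral_cmult)
    also have "\<dots> \<le> (\<Sum>j. ennreal ((1/2) ^ k * (1/2) ^ j))"
      by (intro suminf_le term_le X) auto
    also have "\<dots> = ennreal (2 * (1/2) ^ k)" by (rule geo) simp
    finally show ?thesis .
  qed
  have D_fin: "(\<integral>\<^sup>+ x. D x \<partial>M) \<noteq> \<infinity>"
  proof -
    have "(\<integral>\<^sup>+ x. D x \<partial>M) = (\<Sum>j. ennreal (c j) * emeasure M (A j))"
      unfolding D_def by (simp add: nn_integral_suminf nn_integral_cmult_indicator)
    also have "\<dots> \<le> (\<Sum>j. ennreal (1 * (1/2) ^ j))"
    proof (intro suminf_le)
      fix j
      have "c j \<le> (1/4) ^ j" using c_le[of j] c0[of j] by simp
      also have "\<dots> \<le> 1 * (1/2) ^ j" by (simp, intro power_mono) auto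
      finally have "ennreal (c j) * emeasure M (A j) \<le> ennreal (1 * (1/2) ^ j) * 1"
        by (intro mult_mono ennreal_leI emeasure_le_1) auto
      then show "ennreal (c j) * emeasure M (A j) \<le> ennreal (1 * (1/2) ^ j)" by simp
    qed auto
    also have "\<dots> = ennreal 2" by (subst geo) auto
    also have "\<dots> < \<infinity>" by simp
    finally show ?thesis by simp
  qed
  \<comment> \<open>By Borel-Cantelli almost every point lies in all \<open>B k\<close> from some
    index \<open>j\<close> on, hence in \<open>A j\<close>, where \<open>D\<close> is at least
    \<open>c j > 0\<close>.\<close>
  have D_pos: "AE x in M. D x \<noteq> 0"
  proof -
    have "summable (\<lambda>k. prob (space M - B k))"
    proof (rule summable_comparison_test')
      show "summable (\<lambda>k. 2 * (1/2) ^ k :: real)"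
        by (intro summable_mult summable_geometric) simp
      show "norm (prob (space M - B k)) \<le> 2 * (1/2) ^ k" for k using probB[of k] by simp
    qed
    then have "AE x in M. \<forall>\<^sub>F k in sequentially. x \<in> space M - (space M - B k)"
      by (intro borel_cantelli_AE1) (auto simp: emeasure_eq_measure)
    then show ?thesis
    proof eventually_elim
      case (elim x)
      then obtain j where "\<And>k. k \<ge> j \<Longrightarrow> x \<in> B k" by (auto simp: eventually_sequentially)
      then have "x \<in> A j" by (auto simp: A_def)
      then have "ennreal (c j) * indicator (A j) x \<noteq> 0" using c0[of j] by simp
      then show ?case
        unfolding D_def by (subst suminf_eq_zero_iff) auto
    qed
  qed
  obtain a where a: "0 < a" and Q: "equiv_prob M (density M (\<lambda>x. D x / ennreal a))"
    using equiv_prob_density[OF M _ D_pos D_fin] by auto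
  define Q where "Q = density M (\<lambda>x. D x / ennreal a)"
  have bound: "(SUP X\<in>C. \<integral>\<^sup>+ \<omega>. ennreal (\<bar>X \<omega>\<bar> * indicator {\<omega>. \<bar>X \<omega>\<bar> > real n} \<omega>) \<partial>Q)
      \<le> ennreal (2 * (1/2) ^ k / a)" if n: "n \<ge> m k" for n k
  proof (rule SUP_least)
    fix X assume X: "X \<in> C"
    note [measurable] = meas[OF X]
    have [measurable]: "(\<lambda>\<omega>. \<bar>X \<omega>\<bar> * indicator {\<omega>. \<bar>X \<omega>\<bar> > real n} \<omega>) \<in> borel_measurable M"
    proof -
      have "(\<lambda>\<omega>. \<bar>X \<omega>\<bar> * indicator {\<omega>. \<bar>X \<omega>\<bar> > real n} \<omega>) =
          (\<lambda>\<omega>. if \<bar>X \<omega>\<bar> > real n then \<bar>X \<omega>\<bar> else 0)" by (auto simp: indicator_def)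
      then show ?thesis by simp
    qed
    have "(\<integral>\<^sup>+ \<omega>. ennreal (\<bar>X \<omega>\<bar> * indicator {\<omega>. \<bar>X \<omega>\<bar> > real n} \<omega>) \<partial>Q) =
        (\<integral>\<^sup>+ \<omega>. D \<omega> / ennreal a * ennreal (\<bar>X \<omega>\<bar> * indicator {\<omega>. \<bar>X \<omega>\<bar> > real n} \<omega>) \<partial>M)"
      unfolding Q_def by (rule nn_integral_density) measurable
    also have "\<dots> \<le> (\<integral>\<^sup>+ \<omega>. (D \<omega> * ennreal \<bar>upper_tail (m k) X \<omega>\<bar>) / ennreal a \<partial>M)"
    proof (rule nn_integral_mono_AE)
      show "AE \<omega> in M. D \<omega> / ennreal a * ennreal (\<bar>X \<omega>\<bar> * indicator {\<omega>. \<bar>X \<omega>\<bar> > real n} \<omega>)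
          \<le> (D \<omega> * ennreal \<bar>upper_tail (m k) X \<omega>\<bar>) / ennreal a"
        using pos[OF X]
      proof eventually_elim
        case (elim \<omega>)
        then have "\<bar>X \<omega>\<bar> * indicator {\<omega>. \<bar>X \<omega>\<bar> > real n} \<omega> \<le> \<bar>upper_tail (m k) X \<omega>\<bar>"
          using n by (auto simp: upper_tail_def indicator_def)
        then have "D \<omega> / ennreal a * ennreal (\<bar>X \<omega>\<bar> * indicator {\<omega>. \<bar>X \<omega>\<bar> > real n} \<omega>)
            \<le> D \<omega> / ennreal a * ennreal \<bar>upper_tail (m k) X \<omega>\<bar>"
          by (intro mult_left_mono ennreal_leI) auto
        also have "\<dots> = (D \<omega> * ennreal \<bar>upper_tail (m k) X \<omega>\<bar>) / ennreal a"
          by (simp add: divide_ennreal_def ac_simps)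
        finally show ?case .
      qed
    qed
    also have "\<dots> = (\<integral>\<^sup>+ \<omega>. D \<omega> * ennreal \<bar>upper_tail (m k) X \<omega>\<bar> \<partial>M) / ennreal a"
      by (rule nn_integral_divide) measurable
    also have "\<dots> \<le> ennreal (2 * (1/2) ^ k) / ennreal a"
      by (intro divide_right_mono_ennreal tailD X)
    also have "\<dots> = ennreal (2 * (1/2) ^ k / a)"
      using a by (simp add: divide_ennreal)
    finally show "(\<integral>\<^sup>+ \<omega>. ennreal (\<bar>X \<omega>\<bar> * indicator {\<omega>. \<bar>X \<omega>\<bar> > real n} \<omega>) \<partial>Q) \<le>
        ennreal (2 * (1/2) ^ k / a)" .
  qed
  have "unif_integrable Q C"
    unfolding unif_integrable_def
  proof (rule order_tendstoI)
    fix e :: ennreal assume "0 < e"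
    have "(\<lambda>k. 2 * (1/2) ^ k / a) \<longlonglongrightarrow> 2 * 0 / a"
      using a by (intro tendsto_intros LIMSEQ_power_zero) auto
    then have "(\<lambda>k. ennreal (2 * (1/2) ^ k / a)) \<longlonglongrightarrow> 0"
      by (intro tendsto_ennrealI[where x = 0, simplified]) simp
    then have "\<forall>\<^sub>F k in sequentially. ennreal (2 * (1/2) ^ k / a) < e"
      using \<open>0 < e\<close> by (rule order_tendstoD(2))
    then obtain k where "ennreal (2 * (1/2) ^ k / a) < e" by (auto simp: eventually_sequentially)
    with bound show "\<forall>\<^sub>F n in sequentially.
        (SUP X\<in>C. \<integral>\<^sup>+ \<omega>. ennreal (\<bar>X \<omega>\<bar> * indicator {\<omega>. \<bar>X \<omega>\<bar> > real n} \<omega>) \<partial>Q) < e"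
      unfolding eventually_sequentially by (meson le_less_trans)
  qed simp
  with Q show ?thesis by (auto simp: Q_def)
qed

section \<open>Coincidence of the two topologies under uniform integrability\<close>

lemma L1_topology_if_unif_integrable:
  assumes M: "prob_space M" and Q: "equiv_prob M Q" and C: "C \<subseteq> L0_plus M"
    and UI: "unif_integrable Q C" and X: "X \<in> C"
  shows "rel_nhd (L0_dist M) C X U \<longleftrightarrow> rel_nhd (L1_dist Q) C X U"
proof -
  have pQ: "prob_space Q" and sQ: "sets Q = sets M"
    and null: "\<And>A. A \<in> sets M \<Longrightarrow> emeasure M A = 0 \<longleftrightarrow> emeasure Q A = 0"
    using Q by (auto simp: equiv_prob_def)
  have meas[measurable]: "Y \<in> borel_measurable M" if "Y \<in> C" for Y
    using C that by (auto simp: L0_plus_def)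
  then have measQ[measurable]: "Y \<in> borel_measurable Q" if "Y \<in> C" for Y
    using that by (simp add: measurable_cong_sets[OF sQ refl])
  note [measurable] = meas[OF X] measQ[OF X]
  \<comment> \<open>The L1 distance dominates the L0 distance under \<open>Q\<close>, and absolute
    continuity transfers smallness of the latter from \<open>Q\<close> to \<open>M\<close>.\<close>
  have L1_L0: "\<exists>d>0. \<forall>Y\<in>C. L1_dist Q X Y < d \<longrightarrow> L0_dist M X Y < e" if e: "0 < e" for e
  proof -
    obtain d where d: "0 < d" "\<And>f. f \<in> borel_measurable Q \<Longrightarrow> (\<forall>x. 0 \<le> f x \<and> f x \<le> 1) \<Longrightarrow>
      (\<integral>\<^sup>+ x. ennreal (f x) \<partial>Q) < d \<Longrightarrow> (\<integral>\<^sup>+ x. ennreal (f x) \<partial>M) < e"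
      using nn_integral_abs_continuous[OF pQ M sQ[symmetric] _ e] null sQ by metis
    have "L0_dist M X Y < e" if Y: "Y \<in> C" and less: "L1_dist Q X Y < d" for Y
    proof -
      note [measurable] = measQ[OF Y]
      have "L0_dist Q X Y \<le> L1_dist Q X Y"
        unfolding L0_dist_def L1_dist_def by (intro nn_integral_mono ennreal_leI) simp
      with less show ?thesis
        unfolding L0_dist_def by (intro d(2)) auto
    qed
    with d(1) show ?thesis by blast
  qed
  have L0_L1: "\<exists>d>0. \<forall>Y\<in>C. L0_dist M X Y < d \<longrightarrow> L1_dist Q X Y < e" if e: "0 < e" for e
  proof -
    \<comment> \<open>The radius \<open>e\<close> may be infinite; a real number below it permits
      division.\<close>
    obtain r where r: "0 < r" "ennreal r < e"
    proof -
      obtain z where "0 < z" "z < e" using dense[OF e] by blast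
      then show ?thesis using that[of "enn2real z"]
        by (cases z) (auto simp: less_top)
    qed
    define I where "I n Y = (\<integral>\<^sup>+ \<omega>. ennreal (\<bar>Y \<omega>\<bar> * indicator {\<omega>. \<bar>Y \<omega>\<bar> > real n} \<omega>) \<partial>Q)"
      for n and Y :: "'a \<Rightarrow> real"
    \<comment> \<open>The budget is \<open>r/2\<close> for the truncated part, as \<open>2n\<close>
      times \<open>r/(4n)\<close>, and \<open>r/4\<close> for each of the two tails, as twice
      \<open>r/8\<close>.\<close>
    have "\<forall>\<^sub>F n in sequentially. (SUP Y\<in>C. I n Y) < ennreal (r / 8)"
      using UI r(1) unfolding unif_integrable_def I_def by (intro order_tendstoD(2)) auto
    then obtain n0 where n0: "\<And>n. n \<ge> n0 \<Longrightarrow> (SUP Y\<in>C. I n Y) < ennreal (r / 8)"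
      by (auto simp: eventually_sequentially)
    \<comment> \<open>With \<open>n >= 1\<close> the quotient \<open>r/(4n)\<close> is positive and
      \<open>2n * min 1 |X - Y|\<close> dominates \<open>|X - Y|\<close> whenever the latter is at
      most 1.\<close>
    define n where "n = max 1 n0"
    have n1: "1 \<le> real n" by (simp add: n_def)
    have I: "I n Y \<le> ennreal (r / 8)" if "Y \<in> C" for Y
      using n0[of n] SUP_upper[OF that, of "I n"] by (simp add: n_def)
    have "0 < ennreal (r / (4 * real n))" using r(1) n1 by simp
    from nn_integral_abs_continuous[OF M pQ sQ _ this] null
    obtain d where d: "0 < d" "\<And>f. f \<in> borel_measurable M \<Longrightarrow> (\<forall>x. 0 \<le> f x \<and> f x \<le> 1) \<Longrightarrow>
      (\<integral>\<^sup>+ x. ennreal (f x) \<partial>M) < d \<Longrightarrow> (\<integral>\<^sup>+ x. ennreal (f x) \<partial>Q) < ennreal (r / (4 * real n))"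
      by metis
    have "L1_dist Q X Y < e" if Y: "Y \<in> C" and less: "L0_dist M X Y < d" for Y
    proof -
      note [measurable] = meas[OF Y] measQ[OF Y]
      have ind: "(\<lambda>\<omega>. \<bar>Z \<omega>\<bar> * indicator {\<omega>. \<bar>Z \<omega>\<bar> > real n} \<omega>) =
          (\<lambda>\<omega>. if \<bar>Z \<omega>\<bar> > real n then \<bar>Z \<omega>\<bar> else 0)" for Z :: "'a \<Rightarrow> real"
        by (auto simp: indicator_def)
      have [measurable]: "(\<lambda>\<omega>. \<bar>X \<omega>\<bar> * indicator {\<omega>. \<bar>X \<omega>\<bar> > real n} \<omega>) \<in> borel_measurable Q"
        "(\<lambda>\<omega>. \<bar>Y \<omega>\<bar> * indicator {\<omega>. \<bar>Y \<omega>\<bar> > real n} \<omega>) \<in> borel_measurable Q"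
        unfolding ind by measurable
      have LQ: "L0_dist Q X Y < ennreal (r / (4 * real n))"
        using less unfolding L0_dist_def by (intro d(2)) auto
      have "L1_dist Q X Y \<le> (\<integral>\<^sup>+ \<omega>. ennreal (2 * real n) * ennreal (min 1 \<bar>X \<omega> - Y \<omega>\<bar>) +
          (2 * ennreal (\<bar>X \<omega>\<bar> * indicator {\<omega>. \<bar>X \<omega>\<bar> > real n} \<omega>) +
           2 * ennreal (\<bar>Y \<omega>\<bar> * indicator {\<omega>. \<bar>Y \<omega>\<bar> > real n} \<omega>)) \<partial>Q)"
        unfolding L1_dist_def
      proof (rule nn_integral_mono)
        fix \<omega>
        let ?x = "\<bar>X \<omega>\<bar> * indicator {\<omega>. \<bar>X \<omega>\<bar> > real n} \<omega>"
        let ?y = "\<bar>Y \<omega>\<bar> * indicator {\<omega>. \<bar>Y \<omega>\<bar> > real n} \<omega>"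
        have "\<bar>X \<omega> - Y \<omega>\<bar> \<le> 2 * real n * min 1 \<bar>X \<omega> - Y \<omega>\<bar> + (2 * ?x + 2 * ?y)"
        proof (cases "\<bar>X \<omega>\<bar> \<le> real n \<and> \<bar>Y \<omega>\<bar> \<le> real n")
          case True
          have "\<bar>X \<omega> - Y \<omega>\<bar> \<le> 2 * real n * min 1 \<bar>X \<omega> - Y \<omega>\<bar>"
          proof (cases "\<bar>X \<omega> - Y \<omega>\<bar> \<le> 1")
            case True
            then show ?thesis
              using n1 mult_right_mono[of 1 "2 * real n" "\<bar>X \<omega> - Y \<omega>\<bar>"] by (simp add: min_def)
          qed (use True in auto)
          then show ?thesis by (auto simp: indicator_def)
        next
          \<comment> \<open>The larger of the two absolute values exceeds \<open>n\<close>, so twice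
            its own tail already bounds the difference.\<close>
          case False
          have "\<bar>X \<omega> - Y \<omega>\<bar> \<le> 2 * ?x + 2 * ?y"
            using False by (auto simp: indicator_def)
          moreover have "0 \<le> 2 * real n * min 1 \<bar>X \<omega> - Y \<omega>\<bar>" by simp
          ultimately show ?thesis by linarith
        qed
        then have "ennreal \<bar>X \<omega> - Y \<omega>\<bar> \<le> ennreal (2 * real n * min 1 \<bar>X \<omega> - Y \<omega>\<bar> + (2 * ?x + 2 * ?y))"
          by (rule ennreal_leI)
        also have "\<dots> = ennreal (2 * real n) * ennreal (min 1 \<bar>X \<omega> - Y \<omega>\<bar>) + (2 * ennreal ?x + 2 * ennreal ?y)"
          by (subst ennreal_plus; simp add: ennreal_mult ennreal_plus)
        finally show "ennreal \<bar>X \<omega> - Y \<omega>\<bar> \<le>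
            ennreal (2 * real n) * ennreal (min 1 \<bar>X \<omega> - Y \<omega>\<bar>) + (2 * ennreal ?x + 2 * ennreal ?y)" .
      qed
      also have "\<dots> = ennreal (2 * real n) * L0_dist Q X Y + (2 * I n X + 2 * I n Y)"
        unfolding L0_dist_def I_def by (simp add: nn_integral_add nn_integral_cmult)
      also have "\<dots> \<le> ennreal (2 * real n) * ennreal (r / (4 * real n)) + (2 * ennreal (r / 8) + 2 * ennreal (r / 8))"
        using LQ I[OF X] I[OF Y] by (intro add_mono mult_left_mono) auto
      also have "ennreal (2 * real n) * ennreal (r / (4 * real n)) = ennreal (r / 2)"
        using r(1) n1 by (simp flip: ennreal_mult)
      also have "2 * ennreal (r / 8) = ennreal (r / 4)"
        using r(1) ennreal_mult[of 2 "r / 8"] by simp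
      also have "ennreal (r / 2) + (ennreal (r / 4) + ennreal (r / 4)) = ennreal r"
        using r(1) by (simp flip: ennreal_plus)
      also note r(2)
      finally show ?thesis .
    qed
    with d(1) show ?thesis by blast
  qed
  show ?thesis
  proof
    assume "rel_nhd (L0_dist M) C X U"
    then obtain e where e: "0 < e" "U \<subseteq> C" "{Y\<in>C. L0_dist M X Y < e} \<subseteq> U"
      unfolding rel_nhd_def by blast
    with L1_L0[OF e(1)] show "rel_nhd (L1_dist Q) C X U"
      unfolding rel_nhd_def by blast
  next
    assume "rel_nhd (L1_dist Q) C X U"
    then obtain e where e: "0 < e" "U \<subseteq> C" "{Y\<in>C. L1_dist Q X Y < e} \<subseteq> U"
      unfolding rel_nhd_def by blast
    with L0_L1[OF e(1)] show "rel_nhd (L0_dist M) C X U"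
      unfolding rel_nhd_def by blast
  qed
qed

text \<open>The equivalences follow from a single cycle (1), (5), (4), (3), (2), (1). Solidity puts
  0 into \<open>C\<close> only when \<open>C\<close> is nonempty, so the empty set is treated
  apart.\<close>

theorem theorem3p2:
  fixes M :: "'a measure" and C :: "('a \<Rightarrow> real) set"
  assumes "prob_space M"
    and "C \<subseteq> L0_plus M" and "fconvex C" and "solid M C" and "L0_bounded M C"
  shows "((\<forall>X. (\<forall>n. X n \<in> C) \<and> ((\<lambda>n. L0_dist M (X n) (\<lambda>_. 0)) \<longlonglongrightarrow> 0) \<longrightarrow>
             (\<forall>Y. forward_convex_comb X Y \<longrightarrow> (\<lambda>n. L0_dist M (Y n) (\<lambda>_. 0)) \<longlonglongrightarrow> 0))
          \<longleftrightarrow> convex_nhd_base M C (\<lambda>_. 0))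
       \<and> (convex_nhd_base M C (\<lambda>_. 0) \<longleftrightarrow> (\<forall>X\<in>C. convex_nhd_base M C X))
       \<and> ((\<forall>X\<in>C. convex_nhd_base M C X) \<longleftrightarrow>
            (\<exists>Q. equiv_prob M Q \<and>
               (\<forall>X\<in>C. \<forall>U. rel_nhd (L0_dist M) C X U \<longleftrightarrow> rel_nhd (L1_dist Q) C X U)))
       \<and> ((\<exists>Q. equiv_prob M Q \<and>
               (\<forall>X\<in>C. \<forall>U. rel_nhd (L0_dist M) C X U \<longleftrightarrow> rel_nhd (L1_dist Q) C X U)) \<longleftrightarrow>
            (\<exists>Q. equiv_prob M Q \<and> unif_integrable Q C))"
    (is "(?P1 \<longleftrightarrow> ?P2) \<and> (?P2 \<longleftrightarrow> ?P3) \<and> (?P3 \<longleftrightarrow> ?P4) \<and> (?P4 \<longleftrightarrow> ?P5)")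
proof -
  \<comment> \<open>In these labels the first digit of 12, 23, 34 and 45 is the conclusion and the
    second the premise; 51 likewise derives (5) from (1).\<close>
  have 12: ?P1 if ?P2
    using forward_convex_comb_null[OF that] by blast
  have 23: ?P2 if ?P3
  proof (cases "C = {}")
    case True
    then show ?thesis
      unfolding convex_nhd_base_def rel_nhd_def by (auto simp: fconvex_def)
  next
    case False
    with that solid_zero[OF assms(4,2)] show ?thesis by blast
  qed
  have 34: ?P3 if ?P4
    using that convex_nhd_base_if_L1_topology[OF assms(2,3)] by (auto simp: equiv_prob_def)
  have 45: ?P4 if ?P5
    using that L1_topology_if_unif_integrable[OF assms(1) _ assms(2)] by blast
  have 51: ?P5 if ?P1
  proof (cases "C = {}")
    case True
    have "equiv_prob M M" using assms(1) by (simp add: equiv_prob_def)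
    moreover have "unif_integrable M C"
      \<comment> \<open>The supremum over the empty set is the bottom of \<open>ennreal\<close>,
        namely 0.\<close>
      by (simp add: unif_integrable_def True bot_ennreal)
    ultimately show ?thesis by blast
  next
    case False
    show ?thesis
    proof (rule unif_integrable_if_small_conv_combs[OF assms(1,2,4) False])
      fix e :: ennreal assume "0 < e"
      with that show "\<exists>m. \<forall>Y\<in>conv_combs (upper_tail m ` C). L0_dist M Y (\<lambda>_. 0) \<le> e"
        by (intro small_conv_combs_upper_tails[OF assms(2,4,5) _ False]) blast+
    qed
  qed
  from 12 23 34 45 51 show ?thesis by blast
qed

end
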